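(* Let $\theta>0$, let $(v_n)_{n\ge1}$ be i.i.d. $Be(1,\theta)$ random variables and let $v=v_1$. Let $P=\sum_{n\ge1}w_n\delta_{z_n}$ with $w_n=v_n\prod_{j=1}^{n-1}(1-v_j)$ (a Dirichlet process) and $P'=\sum_{n\ge1}w_n'\delta_{z_n}$ with $w_n'=v(1-v)^{n-1}=v_1(1-v_1)^{n-1}$ (a geometric process), sharing the same locations $(z_n)_{n\ge1}$. Let $\rho=\frac1{\theta+1}$. Then $$\mathbb{E}\big(D_{\mathrm{KL}}(P\|P')\big)=\frac{\theta}{\theta+1},$$ and $$\mathrm{Var}\big(D_{\mathrm{KL}}(P\|P')\big)=(\theta+2)(\theta+1)\,\mathbb{E}\big((1-v_1)^2(1-v_2)\,d(v_2\|v_1)\,d(v_3\|v_1)\big)+\frac{\theta+2}{2}\,\mathbb{E}\Big(\big((1-v_1)\,d(v_2\|v_1)\big)^2\Big)-(1-\rho)^2 .$$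
   Context: $Be(a,b)$ is the beta distribution with mean $a/(a+b)$. The locations $(z_n)_{n\ge1}$ are i.i.d. from a non-atomic probability distribution $P_0$ on a Polish space and independent of the weights. Since the locations are shared, the Kullback-Leibler divergence is the random variable $D_{\mathrm{KL}}(P\|P')=\sum_{n=1}^\infty w_n\log\frac{w_n}{w_n'}$ (the series converges almost surely). The binary divergence is, for $x,y\in(0,1)$, $d(x\|y)=x\log\frac{x}{y}+(1-x)\log\frac{1-x}{1-y}$. *)

theory Defs
  imports "HOL-Probability.Probability"
begin

(* All sequences are indexed from 0: "v 0, v 1, v 2, ..." are v_1, v_2, v_3, ... of the text,
   and likewise for weights and locations. *)

definition beta_density :: "real \<Rightarrow> real \<Rightarrow> real \<Rightarrow> real" where
  "beta_density a b x =
     (if 0 < x \<and> x < 1 then x powr (a - 1) * (1 - x) powr (b - 1) / Beta a b else 0)"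

definition nonatomic :: "'b measure \<Rightarrow> bool" where
  "nonatomic N \<longleftrightarrow>
     (\<forall>A\<in>sets N. 0 < emeasure N A \<longrightarrow>
        (\<exists>B\<in>sets N. B \<subseteq> A \<and> 0 < emeasure N B \<and> emeasure N B < emeasure N A))"

definition stick_weight :: "(nat \<Rightarrow> real) \<Rightarrow> nat \<Rightarrow> real" where
  "stick_weight x n = x n * (\<Prod>j<n. 1 - x j)"

definition geom_weight :: "real \<Rightarrow> nat \<Rightarrow> real" where
  "geom_weight p n = p * (1 - p) ^ n"

definition discrete_measure :: "(nat \<Rightarrow> real) \<Rightarrow> (nat \<Rightarrow> 'b::topological_space) \<Rightarrow> 'b measure" where
  "discrete_measure w x =
     measure_of (space borel) (sets borel)
       (\<lambda>A. \<Sum>n. ennreal (w n) * emeasure (return borel (x n)) A)"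

lemma space_discrete_measure [simp]: "space (discrete_measure w x) = UNIV"
  by (simp add: discrete_measure_def)

lemma sets_discrete_measure [simp, measurable_cong]: "sets (discrete_measure w x) = sets borel"
  unfolding discrete_measure_def by (metis sets.sets_measure_of_eq)

lemma emeasure_discrete_measure:
  fixes x :: "nat \<Rightarrow> 'b::topological_space"
  assumes "A \<in> sets borel"
  shows "emeasure (discrete_measure w x) A = (\<Sum>n. ennreal (w n) * indicator A (x n))"
proof -
  have "countably_additive (sets borel)
          (\<lambda>A. \<Sum>n. ennreal (w n) * emeasure (return borel (x n)) A)"
  proof (rule countably_additiveI)
    fix F :: "nat \<Rightarrow> 'b set"
    assume F: "range F \<subseteq> sets borel" "disjoint_family F"
    have "(\<Sum>i. \<Sum>n. ennreal (w n) * emeasure (return borel (x n)) (F i)) =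
          (\<Sum>n. \<Sum>i. ennreal (w n) * emeasure (return borel (x n)) (F i))"
      unfolding nn_integral_count_space_nat[symmetric]
      by (rule nn_integral_count_space_nn_integral) auto
    also have "\<dots> = (\<Sum>n. ennreal (w n) * emeasure (return borel (x n)) (\<Union>i. F i))"
      using F by (simp add: suminf_emeasure del: emeasure_return)
    finally show "(\<Sum>i. \<Sum>n. ennreal (w n) * emeasure (return borel (x n)) (F i)) =
          (\<Sum>n. ennreal (w n) * emeasure (return borel (x n)) (\<Union>i. F i))" .
  qed
  then have "emeasure (discrete_measure w x) A =
      (\<Sum>n. ennreal (w n) * emeasure (return borel (x n)) A)"
    using assms
    by (intro emeasure_measure_of[OF discrete_measure_def]) (auto simp: positive_def)
  then show ?thesis
    using assms by simp
qed

definition dirichlet_process :: "(nat \<Rightarrow> 'a \<Rightarrow> real) \<Rightarrow> (nat \<Rightarrow> 'a \<Rightarrow> 'b::topological_space) \<Rightarrow> 'a \<Rightarrow> 'b measure" where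
  "dirichlet_process v z \<omega> = discrete_measure (stick_weight (\<lambda>n. v n \<omega>)) (\<lambda>n. z n \<omega>)"

definition geometric_process :: "(nat \<Rightarrow> 'a \<Rightarrow> real) \<Rightarrow> (nat \<Rightarrow> 'a \<Rightarrow> 'b::topological_space) \<Rightarrow> 'a \<Rightarrow> 'b measure" where
  "geometric_process v z \<omega> = discrete_measure (geom_weight (v 0 \<omega>)) (\<lambda>n. z n \<omega>)"

definition KL_term :: "(nat \<Rightarrow> 'a \<Rightarrow> real) \<Rightarrow> 'a \<Rightarrow> nat \<Rightarrow> real" where
  "KL_term v \<omega> n =
     stick_weight (\<lambda>k. v k \<omega>) n * ln (stick_weight (\<lambda>k. v k \<omega>) n / geom_weight (v 0 \<omega>) n)"

(* The divergence D_KL(P||P') between the two processes with shared locations, as the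
   random variable given by the series over the common atoms; the locations do not occur in it. *)
definition D_KL :: "(nat \<Rightarrow> 'a \<Rightarrow> real) \<Rightarrow> 'a \<Rightarrow> real" where
  "D_KL v \<omega> = (\<Sum>n. KL_term v \<omega> n)"

definition binary_div :: "real \<Rightarrow> real \<Rightarrow> real" where
  "binary_div x y = x * ln (x / y) + (1 - x) * ln ((1 - x) / (1 - y))"

end

theory Submission
  imports Defs "HOL-Real_Asymp.Real_Asymp"
begin

text \<open>
Write \<open>S n\<close> for the part of the stick that is left after \<open>n\<close> breaks, \<open>S n = (\<Prod>j<n. 1 - v j)\<close>.
Both weight sequences come from stick breaking, with hazards \<open>v n\<close> for the Dirichlet process and
the constant hazard \<open>v 0\<close> for the geometric one. The chain rule for the relative entropy therefore
splits the divergence along the successive breaks,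
\<open>D = (\<Sum>n. S n * binary_div (v n) (v 0))\<close>, with vanishing term at \<open>n = 0\<close>. For partial sums there is
a boundary term \<open>S N * ln (S N / (1 - v 0) ^ N)\<close>, which tends to 0 almost surely because
\<open>N * S N\<close> has a summable sequence of expectations (lemmas \<open>sum_stick_geom_ln_ratio\<close>,
\<open>stick_geom_ln_ratio_sums\<close>, \<open>AE_KL_term_sums\<close>).

The new terms, called gaps below, are nonnegative, so expectations of the series and of its square
may be computed term by term in the extended nonnegative reals. By independence the factors
\<open>1 - v j\<close> strictly between the breaks of interest split off and contribute powers of
\<open>E (1 - v) = \<theta> / (\<theta> + 1)\<close> or \<open>E (1 - v)^2 = \<theta> / (\<theta> + 2)\<close>, and what remains depends on the
breaks \<open>0, 1, 2\<close> only (lemma \<open>nn_integral_iid_block_times_prod\<close>). The geometric series sum to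
\<open>\<theta> + 1\<close> and \<open>(\<theta> + 2) / 2\<close>, which are the constants in the variance; the off-diagonal terms of the
square occur twice.

For the mean, linearity of \<open>binary_div x y\<close> in the logarithms of \<open>y\<close> and \<open>1 - y\<close>, together with
independence, reduces \<open>E ((1 - v 0) * binary_div (v 1) (v 0))\<close> to
\<open>E ((v - 1 / (\<theta> + 1)) * ln v)\<close>, which is found by integration by parts to be
\<open>\<theta> / (\<theta> + 1)^2\<close>. All integrals are finite because
\<open>(1 - y) * binary_div x y \<le> 5 * y powr (- 1 / 4)\<close> uniformly in \<open>x\<close>, and the square root singularity
\<open>y powr (- 1 / 2)\<close> is integrable for the beta density.

That the series is the divergence of the two random measures rests on the locations being almost
surely distinct: then the Dirichlet process has density \<open>w n / w' n\<close> at the \<open>n\<close>th location with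
respect to the geometric process (lemma \<open>KL_divergence_discrete_measure\<close>).
\<close>

section \<open>The binary divergence\<close>

text \<open>The tangent inequality for the logarithm at 1. It yields nonnegativity of the binary divergence and
bounds the negative parts of the terms of a divergence series by a summable sequence.\<close>

lemma mult_ln_divide_ge_diff:
  fixes x y :: real
  assumes "0 < x" "0 < y"
  shows "x - y \<le> x * ln (x / y)"
proof -
  have "ln (y / x) \<le> y / x - 1"
    using assms by (intro ln_le_minus_one) simp
  then have "x * ln (y / x) \<le> x * (y / x - 1)"
    using assms by (intro mult_left_mono) auto
  then show ?thesis
    using assms by (simp add: ln_div algebra_simps)
qed

lemma binary_div_nonneg:
  assumes "0 < x" "x < 1" "0 < y" "y < 1"
  shows "0 \<le> binary_div x y"
  using mult_ln_divide_ge_diff[of x y] mult_ln_divide_ge_diff[of "1 - x" "1 - y"] assms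
  by (simp add: binary_div_def)

text \<open>A logarithmic singularity at 0 is weaker than any power singularity.\<close>

lemma minus_ln_le_powr:
  fixes y s :: real
  assumes "0 < y" "0 < s"
  shows "- ln y \<le> y powr (- s) / s"
proof -
  have "ln (y powr (- s)) \<le> y powr (- s) - 1"
    using assms by (intro ln_le_minus_one) simp
  then show ?thesis
    using assms by (simp add: ln_powr field_simps)
qed

text \<open>Dropping the two entropy terms in \<open>x\<close>, which are nonpositive, leaves at most
\<open>- ln y - ln (1 - y)\<close>. The factor \<open>1 - y\<close> tames the singularity at 1, and at 0 the exponent \<open>1 / 4\<close>
is chosen such that the square of the bound is still integrable for a beta density that is positive
at 0.\<close>

lemma binary_div_le:
  assumes "0 < x" "x < 1" "0 < y" "y < 1"
  shows "(1 - y) * binary_div x y \<le> 5 * y powr (- 1 / 4)"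
proof -
  have "binary_div x y = x * ln x + (1 - x) * ln (1 - x) + x * - ln y + (1 - x) * - ln (1 - y)"
    using assms by (simp add: binary_div_def ln_div algebra_simps)
  also have "\<dots> \<le> 0 + 0 + 1 * - ln y + 1 * - ln (1 - y)"
    using assms by (intro add_mono mult_right_mono mult_nonneg_nonpos) auto
  finally have "(1 - y) * binary_div x y \<le> (1 - y) * (- ln y - ln (1 - y))"
    using assms by (intro mult_left_mono) auto
  also have "\<dots> = (1 - y) * - ln y - (1 - y) * ln ((1 - y) / 1)"
    by (simp add: algebra_simps)
  also have "\<dots> \<le> 1 * - ln y - ((1 - y) - 1)"
    using assms by (intro diff_mono mult_right_mono mult_ln_divide_ge_diff) auto
  also have "\<dots> \<le> y powr (- 1 / 4) / (1 / 4) + 1"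
    using minus_ln_le_powr[of y "1 / 4"] assms by simp
  also have "\<dots> \<le> y powr (- 1 / 4) / (1 / 4) + y powr (- 1 / 4)"
    using assms powr_mono'[of "- 1 / 4" 0 y] by (intro add_left_mono) simp
  finally show ?thesis
    by simp
qed

lemma measurable_binary_div [measurable (raw)]:
  assumes "f \<in> borel_measurable M" "g \<in> borel_measurable M"
  shows "(\<lambda>w. binary_div (f w) (g w)) \<in> borel_measurable M"
  using assms unfolding binary_div_def by measurable

section \<open>The chain rule along the sticks\<close>

abbreviation residual_mass :: "(nat \<Rightarrow> real) \<Rightarrow> nat \<Rightarrow> real" where
  "residual_mass x n \<equiv> (\<Prod>j<n. 1 - x j)"

text \<open>The chain rule up to the \<open>N\<close>th break. With \<open>L n\<close> for the logarithm of the ratio of the two residual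
masses, the \<open>n\<close>th term on the left is the \<open>n\<close>th binary divergence weighted by the residual mass,
plus the increment of \<open>- residual_mass x n * L n\<close>, so the increments telescope.\<close>

lemma sum_stick_geom_ln_ratio:
  assumes x: "\<And>n. 0 < x n" "\<And>n. x n < 1" and p: "0 < p" "p < 1"
  shows "(\<Sum>n<N. stick_weight x n * ln (stick_weight x n / geom_weight p n)) =
    (\<Sum>n<N. residual_mass x n * binary_div (x n) p) -
      residual_mass x N * ln (residual_mass x N / (1 - p) ^ N)"
proof (induction N)
  case 0
  then show ?case by simp
next
  case (Suc N)
  have pos: "0 < residual_mass x N"
    using x by (intro prod_pos) auto
  have 1: "ln (stick_weight x N / geom_weight p N) =
      ln (x N / p) + ln (residual_mass x N / (1 - p) ^ N)"
    using x[of N] p pos by (subst ln_mult_pos[symmetric]) (auto simp: stick_weight_def geom_weight_def)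
  have 2: "ln (residual_mass x (Suc N) / (1 - p) ^ Suc N) =
      ln ((1 - x N) / (1 - p)) + ln (residual_mass x N / (1 - p) ^ N)"
    using x[of N] p pos by (subst ln_mult_pos[symmetric]) (auto simp: mult.commute)
  have "stick_weight x N * ln (stick_weight x N / geom_weight p N) =
    residual_mass x N * binary_div (x N) p
     + residual_mass x N * ln (residual_mass x N / (1 - p) ^ N)
     - residual_mass x (Suc N) * ln (residual_mass x (Suc N) / (1 - p) ^ Suc N)"
    unfolding 1 2 by (simp add: stick_weight_def binary_div_def algebra_simps)
  with Suc show ?case
    by simp
qed

text \<open>The boundary term splits into \<open>S ln S\<close>, which vanishes with \<open>S\<close>, and \<open>n S ln (1 - p)\<close>, for which
\<open>n S\<close> has to vanish as well.\<close>

lemma residual_mass_ln_ratio_tendsto_0: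
  assumes x: "\<And>n. 0 < x n" "\<And>n. x n < 1" and p: "0 < p" "p < 1"
    and summ: "summable (\<lambda>n. real (Suc n) * residual_mass x n)"
  shows "(\<lambda>n. residual_mass x n * ln (residual_mass x n / (1 - p) ^ n)) \<longlonglongrightarrow> 0"
proof -
  define S where "S = residual_mass x"
  have pos: "0 < S n" for n
    unfolding S_def using x by (intro prod_pos) auto
  have le1: "S n \<le> 1" for n
    unfolding S_def using x by (intro prod_le_1) (auto simp: less_imp_le)
  have lim: "(\<lambda>n. real (Suc n) * S n) \<longlonglongrightarrow> 0"
    using summ unfolding S_def by (rule summable_LIMSEQ_zero)
  have lim_nS: "(\<lambda>n. real n * S n) \<longlonglongrightarrow> 0"
    by (rule tendsto_sandwich[OF _ _ tendsto_const lim]) (use pos in \<open>auto intro!: always_eventually simp: less_imp_le mult_right_mono\<close>)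
  have lim_S: "S \<longlonglongrightarrow> 0"
    by (rule tendsto_sandwich[OF _ _ tendsto_const lim]) (use pos in \<open>auto intro!: always_eventually simp: less_imp_le algebra_simps\<close>)
  have lim_SlnS: "(\<lambda>n. S n * - ln (S n)) \<longlonglongrightarrow> 0"
  proof (rule tendsto_sandwich[OF _ _ tendsto_const])
    show "\<forall>\<^sub>F n in sequentially. 0 \<le> S n * - ln (S n)"
      using pos le1 by (auto intro!: always_eventually mult_nonneg_nonpos simp: less_imp_le)
    have "S n * - ln (S n) \<le> S n powr (1 / 2) * 2" for n
    proof -
      have "S n * - ln (S n) \<le> S n * (S n powr (- (1 / 2)) / (1 / 2))"
        using pos by (intro mult_left_mono minus_ln_le_powr) (auto simp: less_imp_le)
      also have "S n * (S n powr (- (1 / 2)) / (1 / 2)) = S n powr (1 / 2) * 2"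
        using powr_mult_base[of "S n" "- (1 / 2)"] pos by (simp add: less_imp_le)
      finally show ?thesis by (simp add: mult.assoc)
    qed
    then show "\<forall>\<^sub>F n in sequentially. S n * - ln (S n) \<le> S n powr (1 / 2) * 2"
      by simp
    have "(\<lambda>n. S n powr (1 / 2) * 2) \<longlonglongrightarrow> 0 powr (1 / 2) * 2"
      by (intro tendsto_intros lim_S tendsto_powr') (use pos in \<open>auto simp: less_imp_le\<close>)
    then show "(\<lambda>n. S n powr (1 / 2) * 2) \<longlonglongrightarrow> 0"
      by simp
  qed
  have "(\<lambda>n. - (S n * - ln (S n)) - real n * S n * ln (1 - p)) \<longlonglongrightarrow> - 0 - 0 * ln (1 - p)"
    by (intro tendsto_intros lim_SlnS lim_nS)
  also have "(\<lambda>n. - (S n * - ln (S n)) - real n * S n * ln (1 - p)) =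
      (\<lambda>n. S n * ln (S n / (1 - p) ^ n))"
    using pos p by (simp add: fun_eq_iff ln_div ln_realpow algebra_simps)
  finally show ?thesis
    by (simp add: S_def)
qed

lemma stick_geom_ln_ratio_sums:
  assumes x: "\<And>n. 0 < x n" "\<And>n. x n < 1" and p: "0 < p" "p < 1"
    and "summable (\<lambda>n. real (Suc n) * residual_mass x n)"
    and "summable (\<lambda>n. residual_mass x n * binary_div (x n) p)"
  shows "(\<lambda>n. stick_weight x n * ln (stick_weight x n / geom_weight p n)) sums
    (\<Sum>n. residual_mass x n * binary_div (x n) p)"
proof -
  have "(\<lambda>N. (\<Sum>n<N. residual_mass x n * binary_div (x n) p) -
      residual_mass x N * ln (residual_mass x N / (1 - p) ^ N)) \<longlonglongrightarrow>
      (\<Sum>n. residual_mass x n * binary_div (x n) p) - 0"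
    using assms by (intro tendsto_diff summable_LIMSEQ residual_mass_ln_ratio_tendsto_0)
  then show ?thesis
    using assms by (simp add: sums_def sum_stick_geom_ln_ratio)
qed

section \<open>The square of a series\<close>

text \<open>Grouping the double series by the smaller of the two indices: with \<open>R n\<close> for the tail from index \<open>n\<close>
on, the \<open>n\<close>th term is \<open>(R n)^2 - (R (n + 1))^2\<close>.\<close>

lemma square_suminf_sums:
  fixes a :: "nat \<Rightarrow> real"
  assumes "summable a"
  shows "(\<lambda>n. (a n)\<^sup>2 + 2 * (a n * (\<Sum>k. a (n + Suc k)))) sums (\<Sum>n. a n)\<^sup>2"
proof -
  define R where "R n = (\<Sum>k. a (k + n))" for n
  have R: "R n = suminf a - (\<Sum>k<n. a k)" for n
    unfolding R_def by (rule suminf_minus_initial_segment[OF assms])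
  have "R \<longlonglongrightarrow> suminf a - suminf a"
    unfolding R[abs_def] by (intro tendsto_intros summable_LIMSEQ assms)
  then have "(\<lambda>n. (R n)\<^sup>2) \<longlonglongrightarrow> 0"
    using tendsto_power[of R 0 sequentially 2] by simp
  from telescope_sums'[OF this]
  have "(\<lambda>n. (R n)\<^sup>2 - (R (Suc n))\<^sup>2) sums ((R 0)\<^sup>2 - 0)" .
  also have "(\<lambda>n. (R n)\<^sup>2 - (R (Suc n))\<^sup>2) = (\<lambda>n. (a n)\<^sup>2 + 2 * (a n * R (Suc n)))"
  proof
    fix n
    have "R n = a n + R (Suc n)"
      by (simp add: R)
    then show "(R n)\<^sup>2 - (R (Suc n))\<^sup>2 = (a n)\<^sup>2 + 2 * (a n * R (Suc n))"
      by (simp add: power2_eq_square algebra_simps)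
  qed
  finally show ?thesis
    by (simp add: R_def add.commute)
qed

lemma ennreal_square_suminf:
  fixes a :: "nat \<Rightarrow> real"
  assumes "summable a" and nonneg: "\<And>n. 0 \<le> a n"
  shows "ennreal ((\<Sum>n. a n)\<^sup>2) =
    (\<Sum>n. ennreal ((a n)\<^sup>2) + 2 * (\<Sum>k. ennreal (a n * a (n + Suc k))))"
proof -
  have summ: "summable (\<lambda>k. a (n + Suc k))" for n
    using summable_ignore_initial_segment[OF assms(1), of "Suc n"] by (simp add: add.commute)
  have nonneg_tail: "0 \<le> (\<Sum>k. a (n + Suc k))" for n
    by (intro suminf_nonneg summ nonneg)
  have "ennreal ((\<Sum>n. a n)\<^sup>2) = (\<Sum>n. ennreal ((a n)\<^sup>2 + 2 * (a n * (\<Sum>k. a (n + Suc k)))))"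
    using square_suminf_sums[OF assms(1)] nonneg nonneg_tail
    by (subst suminf_ennreal2) (auto simp: sums_iff)
  also have "\<dots> = (\<Sum>n. ennreal ((a n)\<^sup>2) + 2 * (\<Sum>k. ennreal (a n * a (n + Suc k))))"
  proof (intro suminf_cong)
    fix n
    have "(\<Sum>k. ennreal (a n * a (n + Suc k))) = ennreal (a n * (\<Sum>k. a (n + Suc k)))"
      using summ[of n] nonneg by (subst suminf_ennreal2) (auto simp: suminf_mult intro!: summable_mult)
    then show "ennreal ((a n)\<^sup>2 + 2 * (a n * (\<Sum>k. a (n + Suc k)))) =
        ennreal ((a n)\<^sup>2) + 2 * (\<Sum>k. ennreal (a n * a (n + Suc k)))"
      using nonneg nonneg_tail[of n] by (simp add: ennreal_plus ennreal_mult)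
  qed
  finally show ?thesis .
qed

section \<open>Divergence of discrete measures with common atoms\<close>

lemma discrete_measure_eq_distr:
  fixes x :: "nat \<Rightarrow> 'b::topological_space"
  shows "discrete_measure w x = distr (density (count_space UNIV) (\<lambda>n. ennreal (w n))) borel x"
proof (rule measure_eqI)
  fix A assume "A \<in> sets (discrete_measure w x)"
  then have A: "A \<in> sets borel" by simp
  have "indicator (x -` A) n = (indicator A (x n) :: ennreal)" for n
    by (auto simp: indicator_def)
  with A show "emeasure (discrete_measure w x) A =
      emeasure (distr (density (count_space UNIV) (\<lambda>n. ennreal (w n))) borel x) A"
    by (simp add: emeasure_discrete_measure emeasure_distr emeasure_density
        nn_integral_count_space_nat)
qed simp

lemma integral_discrete_measure:
  fixes x :: "nat \<Rightarrow> 'b::topological_space" and g :: "'b \<Rightarrow> real"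
  assumes "\<And>n. 0 \<le> w n" and [measurable]: "g \<in> borel_measurable borel"
    and "summable (\<lambda>n. \<bar>w n * g (x n)\<bar>)"
  shows "(\<integral>y. g y \<partial>discrete_measure w x) = (\<Sum>n. w n * g (x n))"
proof -
  have "integrable (count_space UNIV) (\<lambda>n. w n * g (x n))"
    using assms(3) by (simp add: integrable_count_space_nat_iff)
  then show ?thesis
    using assms(1) by (simp add: discrete_measure_eq_distr integral_distr integral_density
        integral_count_space_nat)
qed

text \<open>Since \<open>x\<close> is injective, the function with value \<open>p n / q n\<close> at \<open>x n\<close> and 0 elsewhere is a density
between the two measures. Absolute summability is needed because the integral that defines the
divergence would otherwise take its default value.\<close>

lemma KL_divergence_discrete_measure:
  fixes x :: "nat \<Rightarrow> 'b::t1_space"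
  assumes p: "\<And>n. 0 < p n" and q: "\<And>n. 0 < q n" "summable q" and "inj x"
    and summ: "summable (\<lambda>n. \<bar>p n * ln (p n / q n)\<bar>)"
  shows "KL_divergence (exp 1) (discrete_measure q x) (discrete_measure p x) =
    (\<Sum>n. p n * ln (p n / q n))"
proof -
  let ?Q = "discrete_measure q x"
  define f where "f y = (\<Sum>n. p n / q n * indicator {x n} y)" for y
  have f_meas [measurable]: "f \<in> borel_measurable borel"
    unfolding f_def by measurable
  have f_x: "f (x n) = p n / q n" for n
  proof -
    have "(\<lambda>m. p m / q m * indicator {x m} (x n)) = (\<lambda>m. if m = n then p m / q m else 0)"
      using \<open>inj x\<close> by (auto simp: fun_eq_iff indicator_def inj_eq)
    then have "(\<lambda>m. p m / q m * indicator {x m} (x n)) sums (p n / q n)"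
      using sums_single[of n "\<lambda>m. p m / q m"] by simp
    then show ?thesis
      by (simp add: f_def sums_iff)
  qed
  interpret sigma_finite_measure ?Q
  proof (rule finite_measure.axioms(1), rule finite_measureI)
    have "(\<Sum>n. ennreal (q n)) \<noteq> top"
      using q by (intro ennreal_suminf_neq_top) (auto simp: less_imp_le)
    then show "emeasure ?Q (space ?Q) \<noteq> \<infinity>"
      by (simp add: emeasure_discrete_measure)
  qed
  have f_nonneg: "AE y in ?Q. 0 \<le> f y"
  proof -
    have "AE n in density (count_space UNIV) (\<lambda>n. ennreal (q n)). 0 \<le> f (x n)"
      using p q by (auto simp: f_x less_imp_le intro!: AE_I2)
    then show ?thesis
      unfolding discrete_measure_eq_distr by (subst AE_distr_iff) auto
  qed
  have "discrete_measure p x = density ?Q (\<lambda>y. ennreal (f y))"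
  proof (rule measure_eqI)
    fix A assume "A \<in> sets (discrete_measure p x)"
    then have [measurable]: "A \<in> sets borel" by simp
    have "emeasure (density ?Q (\<lambda>y. ennreal (f y))) A = 
        (\<Sum>n. ennreal (q n) * (ennreal (f (x n)) * indicator A (x n)))"
      by (simp add: emeasure_density discrete_measure_eq_distr nn_integral_distr
          nn_integral_density nn_integral_count_space_nat)
    also have "\<dots> = (\<Sum>n. ennreal (p n) * indicator A (x n))"
      using p q by (intro suminf_cong)
        (simp add: f_x ennreal_mult'[symmetric] mult.assoc[symmetric] less_imp_le less_imp_neq[symmetric])
    finally show "emeasure (discrete_measure p x) A = emeasure (density ?Q (\<lambda>y. ennreal (f y))) A"
      by (simp add: emeasure_discrete_measure)
  qed simp
  then have "KL_divergence (exp 1) ?Q (discrete_measure p x) = (\<integral>y. f y * log (exp 1) (f y) \<partial>?Q)"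
    using KL_density[of "exp 1" f] f_nonneg by simp
  also have "\<dots> = (\<integral>y. f y * ln (f y) \<partial>?Q)"
    by (simp add: log_def)
  also have "\<dots> = (\<Sum>n. p n * ln (p n / q n))"
    using q p summ
    by (subst integral_discrete_measure) (auto simp: f_x less_imp_le less_imp_neq[symmetric])
  finally show ?thesis .
qed

lemma nonatomic_emeasure_singleton:
  fixes N :: "'b::t1_space measure"
  assumes "nonatomic N" and sets: "sets N = sets borel"
  shows "emeasure N {y} = 0"
proof (rule ccontr)
  assume "emeasure N {y} \<noteq> 0"
  then obtain B where "B \<subseteq> {y}" "0 < emeasure N B" "emeasure N B < emeasure N {y}"
    using assms by (auto simp: nonatomic_def zero_less_iff_neq_zero)
  then show False
    by (auto simp: subset_singleton_iff)
qed

text \<open>The joint law of two distinct coordinates is a product measure with diffuse factors, so by Fubini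
the diagonal is a null set; there are only countably many pairs.\<close>

lemma (in prob_space) AE_indep_vars_inj:
  fixes z :: "nat \<Rightarrow> 'a \<Rightarrow> 'b::{second_countable_topology, t2_space}"
  assumes indep: "indep_vars (\<lambda>_. borel) z UNIV"
    and diffuse: "\<And>n y. emeasure (distr M borel (z n)) {y} = 0"
  shows "AE \<omega> in M. inj (\<lambda>n. z n \<omega>)"
proof -
  have [measurable]: "z n \<in> borel_measurable M" for n
    using indep by (auto simp: indep_vars_def)
  have diag: "{w. fst w \<noteq> snd w} \<in> sets (borel \<Otimes>\<^sub>M borel :: ('b \<times> 'b) measure)"
    unfolding borel_prod by (intro borel_open open_Collect_neq continuous_intros)
  have "AE \<omega> in M. z i \<omega> \<noteq> z j \<omega>" if "i \<noteq> j" for i j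
  proof -
    let ?I = "distr M borel (z i)" and ?J = "distr M borel (z j)"
    interpret I: prob_space ?I by (rule prob_space_distr) simp
    interpret J: prob_space ?J by (rule prob_space_distr) simp
    interpret IJ: pair_prob_space ?I ?J ..
    have "indep_var borel (z i) borel (z j)"
      using indep_var_compose[OF indep_var_restrict[OF indep, of "{i}" "{j}"],
          of "\<lambda>x. x i" borel "\<lambda>x. x j" borel] that
      by (auto simp: comp_def)
    then have eq: "?I \<Otimes>\<^sub>M ?J = distr M (borel \<Otimes>\<^sub>M borel) (\<lambda>\<omega>. (z i \<omega>, z j \<omega>))"
      by (simp add: indep_var_distribution_eq)
    have "AE x in ?I. AE y in ?J. x \<noteq> y"
    proof (rule AE_I2)
      fix x
      show "AE y in ?J. x \<noteq> y"
        using diffuse[of j x] by (intro AE_I[of _ _ "{x}"]) auto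
    qed
    then have "AE w in ?I \<Otimes>\<^sub>M ?J. fst w \<noteq> snd w"
      using diag by (intro IJ.AE_pair_measure) (auto simp: space_pair_measure)
    then show ?thesis
      unfolding eq using diag by (subst (asm) AE_distr_iff) auto
  qed
  then have "AE \<omega> in M. \<forall>i j. i \<noteq> j \<longrightarrow> z i \<omega> \<noteq> z j \<omega>"
    by (simp add: AE_all_countable)
  then show ?thesis
    by eventually_elim (auto simp: inj_def)
qed

section \<open>Factorization for independent identically distributed sequences\<close>

lemma (in prob_space) nn_integral_indep_var_mult:
  fixes f g :: "'b \<Rightarrow> ennreal"
  assumes indep: "indep_var S X T Y"
    and [measurable]: "f \<in> borel_measurable S" "g \<in> borel_measurable T"
  shows "(\<integral>\<^sup>+\<omega>. f (X \<omega>) * g (Y \<omega>) \<partial>M) = (\<integral>\<^sup>+\<omega>. f (X \<omega>) \<partial>M) * (\<integral>\<^sup>+\<omega>. g (Y \<omega>) \<partial>M)"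
proof -
  have [measurable]: "X \<in> measurable M S" "Y \<in> measurable M T"
    using indep by (auto dest: indep_var_rv1 indep_var_rv2)
  let ?X = "distr M S X" and ?Y = "distr M T Y"
  interpret X: prob_space ?X by (rule prob_space_distr) simp
  interpret Y: prob_space ?Y by (rule prob_space_distr) simp
  have "(\<integral>\<^sup>+\<omega>. f (X \<omega>) * g (Y \<omega>) \<partial>M) =
      (\<integral>\<^sup>+w. f (fst w) * g (snd w) \<partial>distr M (S \<Otimes>\<^sub>M T) (\<lambda>\<omega>. (X \<omega>, Y \<omega>)))"
    by (simp add: nn_integral_distr)
  also have "distr M (S \<Otimes>\<^sub>M T) (\<lambda>\<omega>. (X \<omega>, Y \<omega>)) = ?X \<Otimes>\<^sub>M ?Y"
    using indep by (simp add: indep_var_distribution_eq)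
  also have "(\<integral>\<^sup>+w. f (fst w) * g (snd w) \<partial>(?X \<Otimes>\<^sub>M ?Y)) = (\<integral>\<^sup>+x. \<integral>\<^sup>+y. f x * g y \<partial>?Y \<partial>?X)"
    by (subst Y.nn_integral_fst[symmetric]) auto
  also have "\<dots> = (\<integral>\<^sup>+x. f x \<partial>?X) * (\<integral>\<^sup>+y. g y \<partial>?Y)"
    by (simp add: nn_integral_cmult nn_integral_multc)
  finally show ?thesis
    by (simp add: nn_integral_distr)
qed

text \<open>The variables with index in \<open>e ` {..<k}\<close> are independent of those with index in \<open>J\<close>, and their joint
law does not depend on which \<open>k\<close> distinct indices \<open>e\<close> selects. So the block may be moved to the indices
\<open>0, \<dots>, k - 1\<close> while the other factors separate.\<close>

lemma (in prob_space) nn_integral_iid_block_times_prod: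
  fixes v :: "nat \<Rightarrow> 'a \<Rightarrow> 'b" and G :: "(nat \<Rightarrow> 'b) \<Rightarrow> ennreal" and H :: "nat \<Rightarrow> 'b \<Rightarrow> ennreal"
  assumes indep: "indep_vars (\<lambda>_. N) v UNIV"
    and ident: "\<And>n. distr M N (v n) = distr M N (v 0)"
    and e: "inj_on e {..<k}" and k: "0 < k"
    and G [measurable]: "G \<in> borel_measurable (\<Pi>\<^sub>M i\<in>{..<k}. N)"
    and J: "finite J" "J \<inter> e ` {..<k} = {}"
    and H [measurable]: "\<And>j. H j \<in> borel_measurable N"
  shows "(\<integral>\<^sup>+\<omega>. G (\<lambda>i\<in>{..<k}. v (e i) \<omega>) * (\<Prod>j\<in>J. H j (v j \<omega>)) \<partial>M) =
    (\<integral>\<^sup>+\<omega>. G (\<lambda>i\<in>{..<k}. v i \<omega>) \<partial>M) * (\<Prod>j\<in>J. \<integral>\<^sup>+\<omega>. H j (v 0 \<omega>) \<partial>M)"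
proof -
  have v [measurable]: "v n \<in> measurable M N" for n
    using indep by (auto simp: indep_vars_def)
  have H_meas [measurable]: "(\<lambda>x. H j (x j)) \<in> borel_measurable (\<Pi>\<^sub>M j\<in>J. N)" if "j \<in> J" for j
    using that by measurable
  have block: "(\<lambda>x. \<lambda>i\<in>{..<k}. x (e i)) \<in> measurable (\<Pi>\<^sub>M i\<in>e ` {..<k}. N) (\<Pi>\<^sub>M i\<in>{..<k}. N)"
    by measurable
  have law: "distr M (\<Pi>\<^sub>M i\<in>{..<k}. N) (\<lambda>\<omega>. \<lambda>i\<in>{..<k}. v (e' i) \<omega>) =
      (\<Pi>\<^sub>M i\<in>{..<k}. distr M N (v 0))" if "inj_on e' {..<k}" for e'
  proof -
    let ?P = "\<Pi>\<^sub>M i\<in>UNIV. distr M N (v 0)"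
    have "distr M (\<Pi>\<^sub>M i\<in>UNIV. N) (\<lambda>\<omega> i. v i \<omega>) = ?P"
      using indep indep_vars_iff_distr_eq_PiM[where I = UNIV and M' = "\<lambda>_. N" and X = v]
        PiM_cong[OF refl ident, of UNIV "\<lambda>i. i"]
      by (simp add: restrict_UNIV)
    moreover have [measurable]: "(\<lambda>\<omega> i. v i \<omega>) \<in> measurable M (\<Pi>\<^sub>M i\<in>UNIV. N)"
      using measurable_restrict[of UNIV v M "\<lambda>_. N"] by (simp add: restrict_UNIV)
    have "distr (distr M (\<Pi>\<^sub>M i\<in>UNIV. N) (\<lambda>\<omega> i. v i \<omega>)) (\<Pi>\<^sub>M i\<in>{..<k}. N)
        (\<lambda>x. \<lambda>i\<in>{..<k}. x (e' i)) =
      distr M (\<Pi>\<^sub>M i\<in>{..<k}. N) (\<lambda>\<omega>. \<lambda>i\<in>{..<k}. v (e' i) \<omega>)"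
      by (subst distr_distr) (auto simp: comp_def)
    ultimately have "distr M (\<Pi>\<^sub>M i\<in>{..<k}. N) (\<lambda>\<omega>. \<lambda>i\<in>{..<k}. v (e' i) \<omega>) =
        distr ?P (\<Pi>\<^sub>M i\<in>{..<k}. N) (\<lambda>x. \<lambda>i\<in>{..<k}. x (e' i))"
      by simp
    also have "\<dots> = distr ?P (\<Pi>\<^sub>M i\<in>{..<k}. distr M N (v 0)) (\<lambda>x. \<lambda>i\<in>{..<k}. x (e' i))"
      by (intro distr_cong sets_PiM_cong) auto
    also have "\<dots> = (\<Pi>\<^sub>M i\<in>{..<k}. distr M N (v 0))"
      using that by (intro distr_PiM_reindex prob_space_distr v) auto
    finally show ?thesis .
  qed
  have "(\<integral>\<^sup>+\<omega>. G (\<lambda>i\<in>{..<k}. v (e i) \<omega>) * (\<Prod>j\<in>J. H j (v j \<omega>)) \<partial>M) =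
    (\<integral>\<^sup>+\<omega>. G (\<lambda>i\<in>{..<k}. (\<lambda>i\<in>e ` {..<k}. v i \<omega>) (e i)) *
      (\<Prod>j\<in>J. H j ((\<lambda>j\<in>J. v j \<omega>) j)) \<partial>M)"
    by (intro nn_integral_cong arg_cong2[where f = "(*)"] arg_cong[where f = G] prod.cong
        restrict_ext) auto
  also have "\<dots> = (\<integral>\<^sup>+\<omega>. G (\<lambda>i\<in>{..<k}. (\<lambda>i\<in>e ` {..<k}. v i \<omega>) (e i)) \<partial>M) *
      (\<integral>\<^sup>+\<omega>. (\<Prod>j\<in>J. H j ((\<lambda>j\<in>J. v j \<omega>) j)) \<partial>M)"
    using J by (intro nn_integral_indep_var_mult[OF indep_var_restrict[OF indep]]
        measurable_compose[OF block G] borel_measurable_prod_ennreal) auto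
  also have "(\<integral>\<^sup>+\<omega>. G (\<lambda>i\<in>{..<k}. (\<lambda>i\<in>e ` {..<k}. v i \<omega>) (e i)) \<partial>M) =
      (\<integral>\<^sup>+\<omega>. G (\<lambda>i\<in>{..<k}. v (e i) \<omega>) \<partial>M)"
    by (intro nn_integral_cong arg_cong[where f = G] restrict_ext) auto
  also have "\<dots> = (\<integral>\<^sup>+x. G x \<partial>distr M (\<Pi>\<^sub>M i\<in>{..<k}. N) (\<lambda>\<omega>. \<lambda>i\<in>{..<k}. v (e i) \<omega>))"
    by (simp add: nn_integral_distr)
  also have "\<dots> = (\<integral>\<^sup>+x. G x \<partial>distr M (\<Pi>\<^sub>M i\<in>{..<k}. N) (\<lambda>\<omega>. \<lambda>i\<in>{..<k}. v i \<omega>))"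
    using law[OF e] law[of "\<lambda>i. i"] by simp
  also have "\<dots> = (\<integral>\<^sup>+\<omega>. G (\<lambda>i\<in>{..<k}. v i \<omega>) \<partial>M)"
    by (simp add: nn_integral_distr)
  also have "(\<integral>\<^sup>+\<omega>. (\<Prod>j\<in>J. H j ((\<lambda>j\<in>J. v j \<omega>) j)) \<partial>M) = (\<integral>\<^sup>+\<omega>. (\<Prod>j\<in>J. H j (v j \<omega>)) \<partial>M)"
    by simp
  also have "\<dots> = (\<Prod>j\<in>J. \<integral>\<^sup>+\<omega>. H j (v j \<omega>) \<partial>M)"
    using J by (intro indep_vars_nn_integral indep_vars_compose2[OF indep_vars_subset[OF indep]]) auto
  also have "\<dots> = (\<Prod>j\<in>J. \<integral>\<^sup>+\<omega>. H j (v 0 \<omega>) \<partial>M)"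
  proof (intro prod.cong refl)
    fix j
    have "(\<integral>\<^sup>+\<omega>. H j (v n \<omega>) \<partial>M) = (\<integral>\<^sup>+x. H j x \<partial>distr M N (v n))" for n
      by (simp add: nn_integral_distr)
    then show "(\<integral>\<^sup>+\<omega>. H j (v j \<omega>) \<partial>M) = (\<integral>\<^sup>+\<omega>. H j (v 0 \<omega>) \<partial>M)"
      using ident[of j] by simp
  qed
  finally show ?thesis .
qed

section \<open>The beta distribution with first parameter one\<close>

lemma integrable_bounded_mult:
  fixes f g :: "'a \<Rightarrow> real"
  assumes "integrable M f" and [measurable]: "g \<in> borel_measurable M" and "AE \<omega> in M. \<bar>g \<omega>\<bar> \<le> 1"
  shows "integrable M (\<lambda>\<omega>. g \<omega> * f \<omega>)"
proof (rule Bochner_Integration.integrable_bound[OF assms(1)])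
  have [measurable]: "f \<in> borel_measurable M"
    using assms(1) by simp
  show "(\<lambda>\<omega>. g \<omega> * f \<omega>) \<in> borel_measurable M"
    by measurable
  show "AE \<omega> in M. norm (g \<omega> * f \<omega>) \<le> norm (f \<omega>)"
    using assms(3)
  proof eventually_elim
    case (elim \<omega>)
    then show ?case
      using mult_right_mono[of "\<bar>g \<omega>\<bar>" 1 "\<bar>f \<omega>\<bar>"] by (simp add: abs_mult)
  qed
qed

lemma Beta_1_left:
  assumes "0 < (b :: real)"
  shows "Beta 1 b = 1 / b"
proof -
  have "Gamma (1 + b) = b * Gamma b"
    using Gamma_plus1[of b] nonpos_Ints_nonpos[of b] assms by (auto simp: add.commute)
  moreover have "Gamma b \<noteq> 0"
    using Gamma_real_pos[OF assms] by simp
  ultimately show ?thesis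
    by (simp add: Beta_def)
qed

text \<open>The centred density \<open>\<theta> (x - \<rho>) (1 - x)^(\<theta> - 1)\<close> with \<open>\<rho> = 1 / (\<theta> + 1)\<close> is the derivative of
\<open>- \<rho> \<theta> x (1 - x)^\<theta>\<close>. Integrating by parts against the logarithm cancels the factor \<open>x\<close> and leaves
\<open>\<rho> \<theta>\<close> times the integral of \<open>(1 - x)^\<theta>\<close>.\<close>

lemma integral_beta_density_centred_ln:
  fixes \<theta> :: real
  assumes \<theta>: "0 < \<theta>"
    and int: "integrable lborel (\<lambda>x. beta_density 1 \<theta> x * ((x - 1 / (\<theta> + 1)) * ln x))"
  shows "(\<integral>x. beta_density 1 \<theta> x * ((x - 1 / (\<theta> + 1)) * ln x) \<partial>lborel) = \<theta> / (\<theta> + 1)\<^sup>2"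
proof -
  define \<rho> where "\<rho> = 1 / (\<theta> + 1)"
  have \<rho>: "\<rho> * (\<theta> + 1) = 1"
    using \<theta> by (simp add: \<rho>_def)
  define f where "f x = \<theta> * (1 - x) powr (\<theta> - 1) * ((x - \<rho>) * ln x)" for x
  define F where "F x = - (\<rho> * \<theta>) * (x * (1 - x) powr \<theta> * ln x + (1 - x) powr (\<theta> + 1) * \<rho>)" for x
  have eq: "beta_density 1 \<theta> x * ((x - 1 / (\<theta> + 1)) * ln x) = indicator (einterval 0 1) x *\<^sub>R f x" for x
    using \<theta> by (auto simp: beta_density_def f_def \<rho>_def Beta_1_left indicator_def einterval_def)
  have "(LBINT x=0..1. f x) = 0 - (- (\<rho> * \<theta> * \<rho>))"
  proof (rule interval_integral_FTC_integrable)
    fix x assume "0 < ereal x" "ereal x < 1"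
    then have x: "0 < x" "x < 1" by simp_all
    have p: "(1 - x) powr \<theta> = (1 - x) * (1 - x) powr (\<theta> - 1)"
      using x by (simp add: powr_mult_base)
    have "(F has_real_derivative
        - (\<rho> * \<theta>) * (((1 - x) powr \<theta> + x * (- \<theta> * (1 - x) powr (\<theta> - 1))) * ln x +
          x * (1 - x) powr \<theta> * (1 / x) - (\<theta> + 1) * (1 - x) powr \<theta> * \<rho>)) (at x)"
      unfolding F_def using x
      by (auto intro!: derivative_eq_intros simp: algebra_simps)
    also have "- (\<rho> * \<theta>) * (((1 - x) powr \<theta> + x * (- \<theta> * (1 - x) powr (\<theta> - 1))) * ln x +
          x * (1 - x) powr \<theta> * (1 / x) - (\<theta> + 1) * (1 - x) powr \<theta> * \<rho>) =
        - (\<rho> * \<theta>) * (((1 - x) powr \<theta> + x * (- \<theta> * (1 - x) powr (\<theta> - 1))) * ln x +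
          (1 - x) powr \<theta> - (\<rho> * (\<theta> + 1)) * (1 - x) powr \<theta>)"
      using x by simp
    also have "\<dots> = - \<theta> * (1 - x) powr (\<theta> - 1) * (\<rho> - (\<rho> * (\<theta> + 1)) * x) * ln x"
      unfolding \<rho> p using arg_cong[OF \<rho>, of "\<lambda>c. c * (\<theta> * (1 - x) powr (\<theta> - 1) * x * ln x)"]
      by (simp add: algebra_simps)
    also have "\<dots> = f x"
      unfolding \<rho> f_def by (simp add: algebra_simps)
    finally show "(F has_vector_derivative f x) (at x)"
      by (simp add: has_real_derivative_iff_has_vector_derivative)
    show "isCont f x"
      unfolding f_def using x by (auto intro!: continuous_intros)
  next
    show "set_integrable lborel (einterval 0 1) f"
      using int unfolding eq set_integrable_def .
    have "(F \<longlongrightarrow> - (\<rho> * \<theta> * \<rho>)) (at_right 0)"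
      unfolding F_def using \<theta> by real_asymp
    then show "((F \<circ> real_of_ereal) \<longlongrightarrow> - (\<rho> * \<theta> * \<rho>)) (at_right 0)"
      by (simp add: ereal_tendsto_simps zero_ereal_def)
    have "(F \<longlongrightarrow> 0) (at_left 1)"
      unfolding F_def using \<theta> by real_asymp
    then show "((F \<circ> real_of_ereal) \<longlongrightarrow> 0) (at_left 1)"
      by (simp add: ereal_tendsto_simps one_ereal_def)
  qed simp
  also have "0 - (- (\<rho> * \<theta> * \<rho>)) = \<theta> / (\<theta> + 1)\<^sup>2"
    by (simp add: \<rho>_def power2_eq_square)
  finally show ?thesis
    unfolding eq by (simp add: interval_lebesgue_integral_def set_lebesgue_integral_def)
qed

locale beta_sticks = prob_space M for M :: "'a measure" +
  fixes v :: "nat \<Rightarrow> 'a \<Rightarrow> real" and \<theta> :: real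
  assumes theta_pos: "0 < \<theta>"
    and indep: "indep_vars (\<lambda>_. borel) v UNIV"
    and law: "\<And>n. distributed M lborel (v n) (beta_density 1 \<theta>)"
begin

lemma v_measurable [measurable]: "v n \<in> borel_measurable M"
  using indep by (auto simp: indep_vars_def)

lemma v_ident: "distr M borel (v n) = distr M borel (v 0)"
proof -
  have "distr M borel (v n) = density lborel (beta_density 1 \<theta>)" for n
    using distributed_distr_eq_density[OF law[of n]] by (simp cong: distr_cong)
  then show ?thesis by metis
qed

lemma beta_density_nonneg: "0 \<le> beta_density 1 \<theta> x"
  using theta_pos by (simp add: beta_density_def Beta_1_left)

lemma beta_density_measurable [measurable]: "beta_density 1 \<theta> \<in> borel_measurable borel"
  unfolding beta_density_def by measurable

lemma AE_v: "AE \<omega> in M. \<forall>n. 0 < v n \<omega> \<and> v n \<omega> < 1"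
proof -
  have "AE \<omega> in M. 0 < v n \<omega> \<and> v n \<omega> < 1" for n
  proof -
    have "AE x in density lborel (beta_density 1 \<theta>). 0 < x \<and> x < 1"
      by (subst AE_density) (auto simp: beta_density_def)
    then have "AE x in distr M lborel (v n). 0 < x \<and> x < 1"
      by (simp only: distributed_distr_eq_density[OF law[of n]])
    then show ?thesis
      by (subst (asm) AE_distr_iff) auto
  qed
  then show ?thesis
    by (simp add: AE_all_countable)
qed

lemma nn_integral_powr_moment:
  assumes "- 1 < a" "- \<theta> < b"
  shows "(\<integral>\<^sup>+\<omega>. ennreal (v n \<omega> powr a * (1 - v n \<omega>) powr b) \<partial>M) =
    ennreal (Beta (1 + a) (\<theta> + b) * \<theta>)"
proof -
  have "((\<lambda>t. t powr (1 + a - 1) * (1 - t) powr (\<theta> + b - 1)) has_integral Beta (1 + a) (\<theta> + b)) {0..1}"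
    using assms by (intro has_integral_Beta_real) auto
  then have "((\<lambda>t. t powr a * (1 - t) powr (\<theta> + b - 1)) has_integral Beta (1 + a) (\<theta> + b)) {0<..<1}"
    by (simp add: has_integral_Icc_iff_Ioo)
  from has_integral_mult_left[OF this, of \<theta>]
  have *: "((\<lambda>t. t powr a * (1 - t) powr (\<theta> + b - 1) * \<theta>) has_integral
      Beta (1 + a) (\<theta> + b) * \<theta>) {0<..<1}" .
  have "(\<integral>\<^sup>+\<omega>. ennreal (v n \<omega> powr a * (1 - v n \<omega>) powr b) \<partial>M) =
      (\<integral>\<^sup>+x. ennreal (beta_density 1 \<theta> x) * ennreal (x powr a * (1 - x) powr b) \<partial>lborel)"
    by (rule distributed_nn_integral[OF law, symmetric]) measurable
  also have "\<dots> = (\<integral>\<^sup>+x. ennreal (x powr a * (1 - x) powr (\<theta> + b - 1) * \<theta>) *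
      indicator {0<..<1} x \<partial>lborel)"
  proof (rule nn_integral_cong)
    fix x :: real
    show "ennreal (beta_density 1 \<theta> x) * ennreal (x powr a * (1 - x) powr b) =
      ennreal (x powr a * (1 - x) powr (\<theta> + b - 1) * \<theta>) * indicator {0<..<1} x"
      using theta_pos powr_add[of "1 - x" "\<theta> - 1" b]
      by (auto simp: beta_density_def Beta_1_left ennreal_mult[symmetric] algebra_simps indicator_def)
  qed
  also have "\<dots> = ennreal (Beta (1 + a) (\<theta> + b) * \<theta>)"
    using * theta_pos by (intro nn_integral_has_integral_lebesgue') auto
  finally show ?thesis .
qed

lemma nn_integral_one_minus_v: "(\<integral>\<^sup>+\<omega>. ennreal (1 - v n \<omega>) \<partial>M) = ennreal (\<theta> / (\<theta> + 1))"
proof -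
  have "(\<integral>\<^sup>+\<omega>. ennreal (1 - v n \<omega>) \<partial>M) = (\<integral>\<^sup>+\<omega>. ennreal (v n \<omega> powr 0 * (1 - v n \<omega>) powr 1) \<partial>M)"
    by (intro nn_integral_cong_AE) (use AE_v in eventually_elim, auto dest: spec[of _ n])
  then show ?thesis
    using nn_integral_powr_moment[of 0 1 n] theta_pos by (simp add: Beta_1_left)
qed

lemma nn_integral_one_minus_v_sq:
  "(\<integral>\<^sup>+\<omega>. ennreal ((1 - v n \<omega>)\<^sup>2) \<partial>M) = ennreal (\<theta> / (\<theta> + 2))"
proof -
  have "(\<integral>\<^sup>+\<omega>. ennreal ((1 - v n \<omega>)\<^sup>2) \<partial>M) = (\<integral>\<^sup>+\<omega>. ennreal (v n \<omega> powr 0 * (1 - v n \<omega>) powr 2) \<partial>M)"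
    by (intro nn_integral_cong_AE) (use AE_v in eventually_elim, auto dest: spec[of _ n])
  then show ?thesis
    using nn_integral_powr_moment[of 0 2 n] theta_pos by (simp add: Beta_1_left)
qed

text \<open>The exponent \<open>- 1 / 2\<close> is that of the square of the bound for the binary divergence.\<close>

lemma integrable_powr_v: "integrable M (\<lambda>\<omega>. v n \<omega> powr (- 1 / 2))"
proof (rule integrableI_nn_integral_finite)
  have "(\<integral>\<^sup>+\<omega>. ennreal (v n \<omega> powr (- 1 / 2)) \<partial>M) =
      (\<integral>\<^sup>+\<omega>. ennreal (v n \<omega> powr (- 1 / 2) * (1 - v n \<omega>) powr 0) \<partial>M)"
    by (intro nn_integral_cong_AE) (use AE_v in eventually_elim, auto dest: spec[of _ n])
  then show "(\<integral>\<^sup>+\<omega>. ennreal (v n \<omega> powr (- 1 / 2)) \<partial>M) =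
      ennreal (Beta (1 + - 1 / 2) (\<theta> + 0) * \<theta>)"
    using nn_integral_powr_moment[of "- 1 / 2" 0 n] theta_pos by simp
qed auto

section \<open>Moments of the gaps\<close>

text \<open>The contribution of break \<open>n + 1\<close> to the chain rule. The index is shifted because break 0 contributes
nothing: both processes use the hazard \<open>v 0\<close> there.\<close>

definition gap :: "nat \<Rightarrow> 'a \<Rightarrow> real" where
  "gap n \<omega> = residual_mass (\<lambda>k. v k \<omega>) (Suc n) * binary_div (v (Suc n) \<omega>) (v 0 \<omega>)"

lemma gap_measurable [measurable]: "gap n \<in> borel_measurable M"
  unfolding gap_def by measurable

lemma AE_gap_nonneg: "AE \<omega> in M. \<forall>n. 0 \<le> gap n \<omega>"
  using AE_v by eventually_elim
    (auto simp: gap_def less_imp_le intro!: mult_nonneg_nonneg prod_nonneg binary_div_nonneg)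

lemma nn_integral_residual_mass:
  "(\<integral>\<^sup>+\<omega>. ennreal (residual_mass (\<lambda>k. v k \<omega>) n) \<partial>M) = ennreal ((\<theta> / (\<theta> + 1)) ^ n)"
proof -
  have "(\<integral>\<^sup>+\<omega>. ennreal (residual_mass (\<lambda>k. v k \<omega>) n) \<partial>M) =
      (\<integral>\<^sup>+\<omega>. (\<Prod>j<n. ennreal (1 - v j \<omega>)) \<partial>M)"
    by (intro nn_integral_cong_AE) (use AE_v in eventually_elim, auto simp: prod_ennreal less_imp_le)
  also have "\<dots> = (\<Prod>j<n. \<integral>\<^sup>+\<omega>. ennreal (1 - v j \<omega>) \<partial>M)"
    by (intro indep_vars_nn_integral indep_vars_compose2[OF indep_vars_subset[OF indep]]) auto
  finally show ?thesis
    using theta_pos by (simp add: nn_integral_one_minus_v ennreal_power)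
qed

lemma residual_mass_Suc_conv: "residual_mass x (Suc n) = (1 - x 0) * (\<Prod>j\<in>{1..n}. 1 - x j)"
  by (simp add: prod.lessThan_Suc_shift prod.atLeast1_atMost_eq del: prod.lessThan_Suc)

lemma residual_mass_Suc_add_conv:
  "residual_mass x (Suc (n + Suc k)) =
    residual_mass x (Suc n) * (1 - x (Suc n)) * (\<Prod>j\<in>{n + 2..<n + 2 + k}. 1 - x j)"
  by (induction k) (simp_all add: mult_ac)

lemma nn_integral_gap:
  "(\<integral>\<^sup>+\<omega>. ennreal (gap n \<omega>) \<partial>M) =
    (\<integral>\<^sup>+\<omega>. ennreal ((1 - v 0 \<omega>) * binary_div (v 1 \<omega>) (v 0 \<omega>)) \<partial>M) * ennreal ((\<theta> / (\<theta> + 1)) ^ n)"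
proof -
  define e where "e i = (if i = 0 then 0 else Suc n)" for i :: nat
  define G where "G x = ennreal ((1 - x 0) * binary_div (x 1) (x 0))" for x :: "nat \<Rightarrow> real"
  have "(\<integral>\<^sup>+\<omega>. ennreal (gap n \<omega>) \<partial>M) =
      (\<integral>\<^sup>+\<omega>. G (\<lambda>i\<in>{..<2}. v (e i) \<omega>) * (\<Prod>j\<in>{1..n}. ennreal (1 - v j \<omega>)) \<partial>M)"
  proof (intro nn_integral_cong_AE, use AE_v in eventually_elim)
    fix \<omega> assume v: "\<forall>n. 0 < v n \<omega> \<and> v n \<omega> < 1"
    have "gap n \<omega> = ((1 - v 0 \<omega>) * binary_div (v (Suc n) \<omega>) (v 0 \<omega>)) * (\<Prod>j\<in>{1..n}. 1 - v j \<omega>)"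
      unfolding gap_def residual_mass_Suc_conv by simp
    then show "ennreal (gap n \<omega>) = G (\<lambda>i\<in>{..<2}. v (e i) \<omega>) * (\<Prod>j\<in>{1..n}. ennreal (1 - v j \<omega>))"
      using v by (simp add: G_def e_def prod_ennreal less_imp_le ennreal_mult prod_nonneg binary_div_nonneg)
  qed
  also have "\<dots> = (\<integral>\<^sup>+\<omega>. G (\<lambda>i\<in>{..<2}. v i \<omega>) \<partial>M) * (\<Prod>j\<in>{1..n}. \<integral>\<^sup>+\<omega>. ennreal (1 - v 0 \<omega>) \<partial>M)"
    by (rule nn_integral_iid_block_times_prod[OF indep v_ident]) (auto simp: inj_on_def e_def G_def)
  finally show ?thesis
    using theta_pos by (simp add: G_def nn_integral_one_minus_v ennreal_power)
qed

lemma nn_integral_gap_sq: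
  "(\<integral>\<^sup>+\<omega>. ennreal ((gap n \<omega>)\<^sup>2) \<partial>M) =
    (\<integral>\<^sup>+\<omega>. ennreal (((1 - v 0 \<omega>) * binary_div (v 1 \<omega>) (v 0 \<omega>))\<^sup>2) \<partial>M) * ennreal ((\<theta> / (\<theta> + 2)) ^ n)"
proof -
  define e where "e i = (if i = 0 then 0 else Suc n)" for i :: nat
  define G where "G x = ennreal (((1 - x 0) * binary_div (x 1) (x 0))\<^sup>2)" for x :: "nat \<Rightarrow> real"
  have "(\<integral>\<^sup>+\<omega>. ennreal ((gap n \<omega>)\<^sup>2) \<partial>M) =
      (\<integral>\<^sup>+\<omega>. G (\<lambda>i\<in>{..<2}. v (e i) \<omega>) * (\<Prod>j\<in>{1..n}. ennreal ((1 - v j \<omega>)\<^sup>2)) \<partial>M)"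
  proof (intro nn_integral_cong)
    fix \<omega>
    have "(gap n \<omega>)\<^sup>2 = ((1 - v 0 \<omega>) * binary_div (v (Suc n) \<omega>) (v 0 \<omega>))\<^sup>2 * (\<Prod>j\<in>{1..n}. (1 - v j \<omega>)\<^sup>2)"
      unfolding gap_def residual_mass_Suc_conv by (simp add: power_mult_distrib prod_power_distrib)
    then show "ennreal ((gap n \<omega>)\<^sup>2) = G (\<lambda>i\<in>{..<2}. v (e i) \<omega>) * (\<Prod>j\<in>{1..n}. ennreal ((1 - v j \<omega>)\<^sup>2))"
      by (simp add: G_def e_def prod_ennreal ennreal_mult prod_nonneg)
  qed
  also have "\<dots> = (\<integral>\<^sup>+\<omega>. G (\<lambda>i\<in>{..<2}. v i \<omega>) \<partial>M) * (\<Prod>j\<in>{1..n}. \<integral>\<^sup>+\<omega>. ennreal ((1 - v 0 \<omega>)\<^sup>2) \<partial>M)"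
    by (rule nn_integral_iid_block_times_prod[OF indep v_ident]) (auto simp: inj_on_def e_def G_def)
  finally show ?thesis
    using theta_pos by (simp add: G_def nn_integral_one_minus_v_sq ennreal_power)
qed

text \<open>Between two gaps at breaks \<open>i < j\<close>, a factor \<open>1 - v m\<close> occurs squared for \<open>0 < m < i\<close>, since it is in
both residual masses, and once for \<open>i < m < j\<close>. At \<open>m = i\<close> it occurs once and stays in the block, as it
is not independent of the divergence there.\<close>

lemma nn_integral_gap_mult_gap:
  "(\<integral>\<^sup>+\<omega>. ennreal (gap n \<omega> * gap (n + Suc k) \<omega>) \<partial>M) =
    (\<integral>\<^sup>+\<omega>. ennreal ((1 - v 0 \<omega>)\<^sup>2 * (1 - v 1 \<omega>) *
      binary_div (v 1 \<omega>) (v 0 \<omega>) * binary_div (v 2 \<omega>) (v 0 \<omega>)) \<partial>M) *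
    ennreal ((\<theta> / (\<theta> + 2)) ^ n * (\<theta> / (\<theta> + 1)) ^ k)"
proof -
  define e where "e i = (if i = 0 then 0 else if i = 1 then Suc n else Suc (n + Suc k))" for i :: nat
  define G where "G x = ennreal ((1 - x 0)\<^sup>2 * (1 - x 1) * binary_div (x 1) (x 0) * binary_div (x 2) (x 0))"
    for x :: "nat \<Rightarrow> real"
  define A B where "A = {1..n}" and "B = {n + 2..<n + 2 + k}"
  define H where "H j x = ennreal (if j \<le> n then (1 - x)\<^sup>2 else 1 - x)" for j :: nat and x :: real
  have prod_split: "(\<Prod>j\<in>A \<union> B. f j) = (\<Prod>j\<in>A. f j) * (\<Prod>j\<in>B. f j)" for f :: "nat \<Rightarrow> ennreal"
    by (rule prod.union_disjoint) (auto simp: A_def B_def)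
  have "(\<integral>\<^sup>+\<omega>. ennreal (gap n \<omega> * gap (n + Suc k) \<omega>) \<partial>M) =
      (\<integral>\<^sup>+\<omega>. G (\<lambda>i\<in>{..<3}. v (e i) \<omega>) * (\<Prod>j\<in>A \<union> B. H j (v j \<omega>)) \<partial>M)"
  proof (intro nn_integral_cong_AE, use AE_v in eventually_elim)
    fix \<omega> assume v: "\<forall>n. 0 < v n \<omega> \<and> v n \<omega> < 1"
    have "gap n \<omega> * gap (n + Suc k) \<omega> =
      ((1 - v 0 \<omega>)\<^sup>2 * (1 - v (Suc n) \<omega>) * binary_div (v (Suc n) \<omega>) (v 0 \<omega>) *
        binary_div (v (Suc (n + Suc k)) \<omega>) (v 0 \<omega>)) *
      ((\<Prod>j\<in>A. (1 - v j \<omega>)\<^sup>2) * (\<Prod>j\<in>B. 1 - v j \<omega>))"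
      unfolding gap_def residual_mass_Suc_add_conv unfolding residual_mass_Suc_conv A_def B_def
      by (simp only: prod.distrib power2_eq_square mult_ac)
    moreover have "(\<Prod>j\<in>A \<union> B. H j (v j \<omega>)) = ennreal ((\<Prod>j\<in>A. (1 - v j \<omega>)\<^sup>2) * (\<Prod>j\<in>B. 1 - v j \<omega>))"
    proof -
      have "(\<Prod>j\<in>A. H j (v j \<omega>)) = ennreal (\<Prod>j\<in>A. (1 - v j \<omega>)\<^sup>2)"
        by (subst prod_ennreal[symmetric]) (auto simp: A_def H_def intro!: prod.cong)
      moreover have "(\<Prod>j\<in>B. H j (v j \<omega>)) = ennreal (\<Prod>j\<in>B. 1 - v j \<omega>)"
        using v by (subst prod_ennreal[symmetric]) (auto simp: B_def H_def less_imp_le intro!: prod.cong)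
      ultimately show ?thesis
        using v by (simp add: prod_split ennreal_mult prod_nonneg less_imp_le)
    qed
    ultimately show "ennreal (gap n \<omega> * gap (n + Suc k) \<omega>) =
        G (\<lambda>i\<in>{..<3}. v (e i) \<omega>) * (\<Prod>j\<in>A \<union> B. H j (v j \<omega>))"
      using v by (simp add: G_def e_def less_imp_le ennreal_mult[symmetric] prod_nonneg binary_div_nonneg)
  qed
  also have "\<dots> = (\<integral>\<^sup>+\<omega>. G (\<lambda>i\<in>{..<3}. v i \<omega>) \<partial>M) * (\<Prod>j\<in>A \<union> B. \<integral>\<^sup>+\<omega>. H j (v 0 \<omega>) \<partial>M)"
    by (rule nn_integral_iid_block_times_prod[OF indep v_ident])
      (auto simp: inj_on_def e_def G_def A_def B_def H_def split: if_splits)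
  also have "(\<Prod>j\<in>A \<union> B. \<integral>\<^sup>+\<omega>. H j (v 0 \<omega>) \<partial>M) =
      (\<Prod>j\<in>A. ennreal (\<theta> / (\<theta> + 2))) * (\<Prod>j\<in>B. ennreal (\<theta> / (\<theta> + 1)))"
    unfolding prod_split
    by (intro arg_cong2[where f = "(*)"] prod.cong refl)
      (auto simp: A_def B_def H_def nn_integral_one_minus_v nn_integral_one_minus_v_sq)
  finally show ?thesis
    using theta_pos by (simp add: G_def A_def B_def ennreal_power ennreal_mult)
qed

section \<open>Integrability and the mean of one gap\<close>

lemma AE_one_minus_v_mult_binary_div_le:
  "AE \<omega> in M. \<forall>n. 0 \<le> (1 - v 0 \<omega>) * binary_div (v n \<omega>) (v 0 \<omega>) \<and>
    (1 - v 0 \<omega>) * binary_div (v n \<omega>) (v 0 \<omega>) \<le> 5 * v 0 \<omega> powr (- 1 / 4)"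
  using AE_v
proof eventually_elim
  case (elim \<omega>)
  show ?case
  proof (intro allI conjI)
    fix n
    show "0 \<le> (1 - v 0 \<omega>) * binary_div (v n \<omega>) (v 0 \<omega>)"
      using elim by (intro mult_nonneg_nonneg binary_div_nonneg) (auto simp: less_imp_le)
    show "(1 - v 0 \<omega>) * binary_div (v n \<omega>) (v 0 \<omega>) \<le> 5 * v 0 \<omega> powr (- 1 / 4)"
      using elim by (intro binary_div_le) auto
  qed
qed

lemma integrable_one_minus_v_mult_binary_div:
  "integrable M (\<lambda>\<omega>. (1 - v 0 \<omega>) * binary_div (v 1 \<omega>) (v 0 \<omega>))"
proof (rule Bochner_Integration.integrable_bound)
  show "integrable M (\<lambda>\<omega>. 5 * v 0 \<omega> powr (- 1 / 2))"
    using integrable_powr_v by simp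
  show "AE \<omega> in M. norm ((1 - v 0 \<omega>) * binary_div (v 1 \<omega>) (v 0 \<omega>)) \<le> norm (5 * v 0 \<omega> powr (- 1 / 2))"
    using AE_v AE_one_minus_v_mult_binary_div_le
  proof eventually_elim
    case (elim \<omega>)
    have "v 0 \<omega> powr (- 1 / 4) \<le> v 0 \<omega> powr (- 1 / 2)"
      using elim(1) by (intro powr_mono') (auto simp: less_imp_le)
    with elim(2)[rule_format, of 1] show ?case
      by simp
  qed
qed measurable

lemma integrable_one_minus_v_mult_binary_div_sq:
  "integrable M (\<lambda>\<omega>. ((1 - v 0 \<omega>) * binary_div (v 1 \<omega>) (v 0 \<omega>))\<^sup>2)"
proof (rule Bochner_Integration.integrable_bound)
  show "integrable M (\<lambda>\<omega>. 25 * v 0 \<omega> powr (- 1 / 2))"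
    using integrable_powr_v by simp
  show "AE \<omega> in M. norm (((1 - v 0 \<omega>) * binary_div (v 1 \<omega>) (v 0 \<omega>))\<^sup>2) \<le> norm (25 * v 0 \<omega> powr (- 1 / 2))"
    using AE_one_minus_v_mult_binary_div_le
  proof eventually_elim
    case (elim \<omega>)
    then have "((1 - v 0 \<omega>) * binary_div (v 1 \<omega>) (v 0 \<omega>))\<^sup>2 \<le> (5 * v 0 \<omega> powr (- 1 / 4))\<^sup>2"
      by (intro power_mono) auto
    also have "\<dots> = 25 * v 0 \<omega> powr (- 1 / 2)"
      by (simp add: power2_eq_square powr_add[symmetric])
    finally show ?case by simp
  qed
qed measurable

lemma integrable_binary_div_mult_binary_div:
  "integrable M (\<lambda>\<omega>. (1 - v 0 \<omega>)\<^sup>2 * (1 - v 1 \<omega>) *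
    binary_div (v 1 \<omega>) (v 0 \<omega>) * binary_div (v 2 \<omega>) (v 0 \<omega>))"
proof (rule Bochner_Integration.integrable_bound)
  show "integrable M (\<lambda>\<omega>. 25 * v 0 \<omega> powr (- 1 / 2))"
    using integrable_powr_v by simp
  show "AE \<omega> in M. norm ((1 - v 0 \<omega>)\<^sup>2 * (1 - v 1 \<omega>) *
    binary_div (v 1 \<omega>) (v 0 \<omega>) * binary_div (v 2 \<omega>) (v 0 \<omega>)) \<le> norm (25 * v 0 \<omega> powr (- 1 / 2))"
    using AE_v AE_one_minus_v_mult_binary_div_le
  proof eventually_elim
    case (elim \<omega>)
    define d where "d n = (1 - v 0 \<omega>) * binary_div (v n \<omega>) (v 0 \<omega>)" for n
    define c where "c = 5 * v 0 \<omega> powr (- 1 / 4)"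
    have d: "0 \<le> d n" "d n \<le> c" for n
      using elim(2) by (auto simp: d_def c_def)
    have eq: "(1 - v 0 \<omega>)\<^sup>2 * (1 - v 1 \<omega>) * binary_div (v 1 \<omega>) (v 0 \<omega>) * binary_div (v 2 \<omega>) (v 0 \<omega>) =
        (1 - v 1 \<omega>) * (d 1 * d 2)"
      by (simp add: d_def power2_eq_square mult_ac)
    have "0 \<le> (1 - v 1 \<omega>) * (d 1 * d 2)"
      using elim(1) d by (intro mult_nonneg_nonneg) (auto simp: less_imp_le)
    then have "norm ((1 - v 1 \<omega>) * (d 1 * d 2)) = (1 - v 1 \<omega>) * (d 1 * d 2)"
      unfolding real_norm_def by (rule abs_of_nonneg)
    also have "\<dots> \<le> 1 * (c * c)"
      using elim(1) d order_trans[OF d(1) d(2)]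
      by (intro mult_mono mult_nonneg_nonneg) (auto simp: less_imp_le)
    also have "\<dots> = norm (25 * v 0 \<omega> powr (- 1 / 2))"
      by (simp add: c_def powr_add[symmetric])
    finally show ?case
      unfolding eq .
  qed
qed measurable

lemma integrable_ln_v: "integrable M (\<lambda>\<omega>. ln (v n \<omega>))"
proof (rule Bochner_Integration.integrable_bound)
  show "integrable M (\<lambda>\<omega>. v n \<omega> powr (- 1 / 2) * 2)"
    using integrable_powr_v by simp
  show "AE \<omega> in M. norm (ln (v n \<omega>)) \<le> norm (v n \<omega> powr (- 1 / 2) * 2)"
    using AE_v
  proof eventually_elim
    case (elim \<omega>)
    then show ?case
      using minus_ln_le_powr[of "v n \<omega>" "1 / 2"] by (simp add: abs_of_nonpos less_imp_le)
  qed
qed measurable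

lemma expectation_ident:
  "(g :: real \<Rightarrow> real) \<in> borel_measurable borel \<Longrightarrow> expectation (\<lambda>\<omega>. g (v n \<omega>)) = expectation (\<lambda>\<omega>. g (v 0 \<omega>))"
  using integral_distr[of "v n" M borel g] integral_distr[of "v 0" M borel g] v_ident[of n] by simp

text \<open>Expand the binary divergence into entropy terms in \<open>v 1\<close> and logarithms of \<open>v 0\<close> and \<open>1 - v 0\<close>, and
factor by independence. With \<open>q = E (1 - v)\<close> the terms \<open>q * E ((1 - v) ln (1 - v))\<close> cancel, and
\<open>q v - (1 - q) (1 - v) = v - (1 - q)\<close> combines the others into \<open>E ((v - 1 / (\<theta> + 1)) ln v)\<close>.\<close>

lemma expectation_one_minus_v_mult_binary_div:
  "expectation (\<lambda>\<omega>. (1 - v 0 \<omega>) * binary_div (v 1 \<omega>) (v 0 \<omega>)) = \<theta> / (\<theta> + 1)\<^sup>2"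
proof -
  define q where "q = \<theta> / (\<theta> + 1)"
  have v_bounds: "AE \<omega> in M. 0 < v n \<omega>" "AE \<omega> in M. v n \<omega> < 1" for n
    using AE_v by auto
  have AE_abs: "AE \<omega> in M. \<bar>v n \<omega>\<bar> \<le> 1" "AE \<omega> in M. \<bar>1 - v n \<omega>\<bar> \<le> 1" for n
    by (use AE_v in eventually_elim, auto simp: less_imp_le)+
  have int_v: "integrable M (\<lambda>\<omega>. v n \<omega>)" for n
    using AE_abs by (intro integrable_const_bound[where B = 1]) auto
  have AE_xlnx: "AE \<omega> in M. \<bar>(1 - v n \<omega>) * ln (1 - v n \<omega>)\<bar> \<le> 1" for n
  proof (use AE_v in eventually_elim)
    fix \<omega> assume v: "\<forall>n. 0 < v n \<omega> \<and> v n \<omega> < 1"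
    then have "(1 - v n \<omega>) * ln (1 - v n \<omega>) \<le> 0"
      by (intro mult_nonneg_nonpos) (auto simp: less_imp_le)
    moreover have "1 - v n \<omega> - 1 \<le> (1 - v n \<omega>) * ln ((1 - v n \<omega>) / 1)"
      using v by (intro mult_ln_divide_ge_diff) auto
    moreover have "v n \<omega> < 1"
      using v by auto
    ultimately show "\<bar>(1 - v n \<omega>) * ln (1 - v n \<omega>)\<bar> \<le> 1"
      by simp
  qed
  have int_ln: "integrable M (\<lambda>\<omega>. v n \<omega> * ln (v n \<omega>))" for n
    by (intro integrable_bounded_mult integrable_ln_v AE_abs) auto
  have int_ln': "integrable M (\<lambda>\<omega>. (1 - v n \<omega>) * ln (v n \<omega>))" for n
    by (intro integrable_bounded_mult integrable_ln_v AE_abs) auto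
  have int_xlnx: "integrable M (\<lambda>\<omega>. (1 - v n \<omega>) * ln (1 - v n \<omega>))" for n
    using AE_xlnx by (intro integrable_const_bound[where B = 1]) auto
  have ind: "indep_var borel (\<lambda>\<omega>. f (v 0 \<omega>)) borel (\<lambda>\<omega>. g (v 1 \<omega>))"
    if "f \<in> borel_measurable borel" "g \<in> borel_measurable borel" for f g :: "real \<Rightarrow> real"
    using indep_var_compose[OF indep_var_restrict[OF indep, of "{0}" "{1}"],
        of "\<lambda>x. f (x 0)" borel "\<lambda>x. g (x 1)" borel] that
    by (auto simp: comp_def)
  have split: "integrable M (\<lambda>\<omega>. f (v 0 \<omega>) * g (v 1 \<omega>))"
    "expectation (\<lambda>\<omega>. f (v 0 \<omega>) * g (v 1 \<omega>)) = expectation (\<lambda>\<omega>. f (v 0 \<omega>)) * expectation (\<lambda>\<omega>. g (v 0 \<omega>))"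
    if f: "f \<in> borel_measurable borel" and g: "g \<in> borel_measurable borel"
      and int: "integrable M (\<lambda>\<omega>. f (v 0 \<omega>))" "integrable M (\<lambda>\<omega>. g (v 1 \<omega>))" for f g :: "real \<Rightarrow> real"
    using indep_var_integrable[OF ind[OF f g] int] indep_var_lebesgue_integral[OF ind[OF f g] int]
    unfolding expectation_ident[OF g, of 1] .
  have E_1v: "expectation (\<lambda>\<omega>. 1 - v 0 \<omega>) = q"
    unfolding q_def using theta_pos AE_v
    by (intro integral_eq_nn_integral[THEN trans])
      (auto simp: nn_integral_one_minus_v less_imp_le elim!: eventually_mono)
  then have E_v: "expectation (\<lambda>\<omega>. v 0 \<omega>) = 1 - q"
    using Bochner_Integration.integral_diff[OF integrable_const int_v, of 1 0] by (simp add: prob_space)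
  let ?e = "\<lambda>x :: real. x * ln x + (1 - x) * ln (1 - x)"
  have "expectation (\<lambda>\<omega>. (1 - v 0 \<omega>) * binary_div (v 1 \<omega>) (v 0 \<omega>)) =
      expectation (\<lambda>\<omega>. (1 - v 0 \<omega>) * ?e (v 1 \<omega>) - ((1 - v 0 \<omega>) * ln (v 0 \<omega>)) * v 1 \<omega> -
        ((1 - v 0 \<omega>) * ln (1 - v 0 \<omega>)) * (1 - v 1 \<omega>))"
  proof (intro integral_cong_AE, measurable, use AE_v in eventually_elim)
    fix \<omega> assume v: "\<forall>n. 0 < v n \<omega> \<and> v n \<omega> < 1"
    then have "0 < v 0 \<omega>" "0 < v 1 \<omega>" "0 < 1 - v 0 \<omega>" "0 < 1 - v 1 \<omega>"
      by auto
    then show "(1 - v 0 \<omega>) * binary_div (v 1 \<omega>) (v 0 \<omega>) =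
      (1 - v 0 \<omega>) * ?e (v 1 \<omega>) - ((1 - v 0 \<omega>) * ln (v 0 \<omega>)) * v 1 \<omega> -
        ((1 - v 0 \<omega>) * ln (1 - v 0 \<omega>)) * (1 - v 1 \<omega>)"
      by (simp add: binary_div_def ln_div algebra_simps)
  qed
  also have "\<dots> = q * expectation (\<lambda>\<omega>. ?e (v 0 \<omega>)) -
      expectation (\<lambda>\<omega>. (1 - v 0 \<omega>) * ln (v 0 \<omega>)) * (1 - q) -
      expectation (\<lambda>\<omega>. (1 - v 0 \<omega>) * ln (1 - v 0 \<omega>)) * q"
  proof -
    have int_e: "integrable M (\<lambda>\<omega>. ?e (v n \<omega>))" for n
      by (intro Bochner_Integration.integrable_add int_ln int_xlnx)
    have int_1v: "integrable M (\<lambda>\<omega>. 1 - v n \<omega>)" for n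
      by (intro Bochner_Integration.integrable_diff int_v integrable_const)
    have meas: "(\<lambda>x. 1 - x) \<in> borel_measurable (borel :: real measure)"
      "(\<lambda>x. x) \<in> borel_measurable (borel :: real measure)"
      "?e \<in> borel_measurable borel" "(\<lambda>x :: real. (1 - x) * ln x) \<in> borel_measurable borel"
      "(\<lambda>x :: real. (1 - x) * ln (1 - x)) \<in> borel_measurable borel"
      by measurable
    note 1 = split[OF meas(1) meas(3) int_1v int_e, unfolded E_1v]
    note 2 = split[OF meas(4) meas(2) int_ln' int_v, unfolded E_v]
    note 3 = split[OF meas(5) meas(1) int_xlnx int_1v, unfolded E_1v]
    show ?thesis
      by (subst Bochner_Integration.integral_diff[OF Bochner_Integration.integrable_diff[OF 1(1) 2(1)] 3(1)],
          subst Bochner_Integration.integral_diff[OF 1(1) 2(1)]) (simp only: 1 2 3)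
  qed
  also have "\<dots> = q * expectation (\<lambda>\<omega>. v 0 \<omega> * ln (v 0 \<omega>)) -
      (1 - q) * expectation (\<lambda>\<omega>. (1 - v 0 \<omega>) * ln (v 0 \<omega>))"
    unfolding Bochner_Integration.integral_add[OF int_ln int_xlnx] by (simp only: algebra_simps)
  also have "\<dots> = expectation (\<lambda>\<omega>. q * (v 0 \<omega> * ln (v 0 \<omega>)) - (1 - q) * ((1 - v 0 \<omega>) * ln (v 0 \<omega>)))"
    by (simp only: Bochner_Integration.integral_diff[OF integrable_mult_right[OF int_ln]
          integrable_mult_right[OF int_ln']] integral_mult_right_zero)
  also have "(\<lambda>\<omega>. q * (v 0 \<omega> * ln (v 0 \<omega>)) - (1 - q) * ((1 - v 0 \<omega>) * ln (v 0 \<omega>))) =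
      (\<lambda>\<omega>. (v 0 \<omega> - 1 / (\<theta> + 1)) * ln (v 0 \<omega>))"
  proof
    fix \<omega>
    have "1 / (\<theta> + 1) = 1 - q"
      using theta_pos by (simp add: q_def field_simps)
    then show "q * (v 0 \<omega> * ln (v 0 \<omega>)) - (1 - q) * ((1 - v 0 \<omega>) * ln (v 0 \<omega>)) =
        (v 0 \<omega> - 1 / (\<theta> + 1)) * ln (v 0 \<omega>)"
      by (simp only:) (simp add: algebra_simps)
  qed
  also have "expectation \<dots> = (\<integral>x. beta_density 1 \<theta> x * ((x - 1 / (\<theta> + 1)) * ln x) \<partial>lborel)"
    using beta_density_nonneg by (intro distributed_integral[OF law, symmetric]) auto
  also have "\<dots> = \<theta> / (\<theta> + 1)\<^sup>2"
  proof (rule integral_beta_density_centred_ln[OF theta_pos])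
    have "integrable M (\<lambda>\<omega>. v 0 \<omega> * ln (v 0 \<omega>) - 1 / (\<theta> + 1) * ln (v 0 \<omega>))"
      using integrable_ln_v int_ln by (intro Bochner_Integration.integrable_diff) auto
    then have "integrable M (\<lambda>\<omega>. (v 0 \<omega> - 1 / (\<theta> + 1)) * ln (v 0 \<omega>))"
      by (simp add: left_diff_distrib)
    then show "integrable lborel (\<lambda>x. beta_density 1 \<theta> x * ((x - 1 / (\<theta> + 1)) * ln x))"
      using beta_density_nonneg by (subst distributed_integrable[OF law, where g = "\<lambda>x. (x - 1 / (\<theta> + 1)) * ln x"]) auto
  qed
  finally show ?thesis .
qed

section \<open>The divergence and its first two moments\<close>

lemma geometric_mean_sums: "(\<lambda>n. (\<theta> / (\<theta> + 1)) ^ n) sums (\<theta> + 1)"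
proof -
  have eq: "1 / (1 - \<theta> / (\<theta> + 1)) = \<theta> + 1"
    using theta_pos by (simp add: field_simps)
  have "(\<lambda>n. (\<theta> / (\<theta> + 1)) ^ n) sums (1 / (1 - \<theta> / (\<theta> + 1)))"
    using theta_pos by (intro geometric_sums) simp
  then show ?thesis
    unfolding eq .
qed

lemma geometric_second_moment_sums: "(\<lambda>n. (\<theta> / (\<theta> + 2)) ^ n) sums ((\<theta> + 2) / 2)"
proof -
  have eq: "1 / (1 - \<theta> / (\<theta> + 2)) = (\<theta> + 2) / 2"
    using theta_pos by (simp add: field_simps)
  have "(\<lambda>n. (\<theta> / (\<theta> + 2)) ^ n) sums (1 / (1 - \<theta> / (\<theta> + 2)))"
    using theta_pos by (intro geometric_sums) simp
  then show ?thesis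
    unfolding eq .
qed

lemma nn_integral_suminf_gap:
  "(\<integral>\<^sup>+\<omega>. (\<Sum>n. ennreal (gap n \<omega>)) \<partial>M) = ennreal (\<theta> / (\<theta> + 1))"
proof -
  have "AE \<omega> in M. 0 \<le> (1 - v 0 \<omega>) * binary_div (v 1 \<omega>) (v 0 \<omega>)"
    using AE_one_minus_v_mult_binary_div_le by eventually_elim auto
  then have *: "(\<integral>\<^sup>+\<omega>. ennreal ((1 - v 0 \<omega>) * binary_div (v 1 \<omega>) (v 0 \<omega>)) \<partial>M) = ennreal (\<theta> / (\<theta> + 1)\<^sup>2)"
    using integrable_one_minus_v_mult_binary_div
    by (subst nn_integral_eq_integral) (auto simp: expectation_one_minus_v_mult_binary_div[simplified])
  have "(\<integral>\<^sup>+\<omega>. (\<Sum>n. ennreal (gap n \<omega>)) \<partial>M) = (\<Sum>n. \<integral>\<^sup>+\<omega>. ennreal (gap n \<omega>) \<partial>M)"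
    by (intro nn_integral_suminf) measurable
  also have "\<dots> = (\<Sum>n. ennreal (\<theta> / (\<theta> + 1)\<^sup>2 * (\<theta> / (\<theta> + 1)) ^ n))"
    unfolding nn_integral_gap * using theta_pos by (intro suminf_cong) (simp add: ennreal_mult[symmetric])
  also have "\<dots> = ennreal (\<theta> / (\<theta> + 1)\<^sup>2 * (\<theta> + 1))"
    using theta_pos by (intro suminf_ennreal_eq sums_mult geometric_mean_sums) simp
  also have "\<theta> / (\<theta> + 1)\<^sup>2 * (\<theta> + 1) = \<theta> / (\<theta> + 1)"
    using theta_pos by (simp add: power2_eq_square)
  finally show ?thesis .
qed

lemma AE_summable_gap: "AE \<omega> in M. summable (\<lambda>n. gap n \<omega>)"
proof -
  have "AE \<omega> in M. (\<Sum>n. ennreal (gap n \<omega>)) \<noteq> \<infinity>"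
    by (rule nn_integral_PInf_AE) (auto simp: nn_integral_suminf_gap)
  then show ?thesis
    using AE_gap_nonneg by eventually_elim (auto intro: summable_suminf_not_top)
qed

text \<open>The expectations \<open>(n + 1) * q ^ n\<close> with \<open>q = \<theta> / (\<theta> + 1)\<close> are summable.\<close>

lemma AE_summable_Suc_mult_residual_mass:
  "AE \<omega> in M. summable (\<lambda>n. real (Suc n) * residual_mass (\<lambda>k. v k \<omega>) n)"
proof -
  let ?f = "\<lambda>\<omega> n. real (Suc n) * residual_mass (\<lambda>k. v k \<omega>) n"
  let ?q = "\<theta> / (\<theta> + 1)"
  have "(\<integral>\<^sup>+\<omega>. (\<Sum>n. ennreal (?f \<omega> n)) \<partial>M) = (\<Sum>n. \<integral>\<^sup>+\<omega>. ennreal (?f \<omega> n) \<partial>M)"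
    by (intro nn_integral_suminf) measurable
  also have "\<dots> = (\<Sum>n. ennreal (real (Suc n) * ?q ^ n))"
    using theta_pos by (simp add: ennreal_mult' nn_integral_cmult nn_integral_residual_mass del: of_nat_Suc)
  also have "\<dots> = ennreal (1 / (1 - ?q)\<^sup>2)"
    using theta_pos by (intro suminf_ennreal_eq geometric_deriv_sums) auto
  finally have "AE \<omega> in M. (\<Sum>n. ennreal (?f \<omega> n)) \<noteq> \<infinity>"
    by (intro nn_integral_PInf_AE) auto
  then show ?thesis
    using AE_v
  proof eventually_elim
    case (elim \<omega>)
    then show ?case
      by (intro summable_suminf_not_top) (auto intro!: mult_nonneg_nonneg prod_nonneg simp: less_imp_le)
  qed
qed

lemma AE_KL_term_sums: "AE \<omega> in M. KL_term v \<omega> sums (\<Sum>n. gap n \<omega>)"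
  using AE_v AE_summable_gap AE_summable_Suc_mult_residual_mass
proof eventually_elim
  case (elim \<omega>)
  let ?a = "\<lambda>n. residual_mass (\<lambda>k. v k \<omega>) n * binary_div (v n \<omega>) (v 0 \<omega>)"
  have gap: "gap n \<omega> = ?a (Suc n)" for n
    by (simp add: gap_def)
  have "?a 0 = 0"
    by (simp add: binary_div_def)
  moreover have "(\<lambda>n. ?a (Suc n)) sums (\<Sum>n. gap n \<omega>)"
    using elim(2) unfolding gap by (rule summable_sums)
  ultimately have sums: "?a sums (\<Sum>n. gap n \<omega>)"
    using sums_Suc_iff[of ?a] by simp
  have "(\<lambda>n. stick_weight (\<lambda>k. v k \<omega>) n *
      ln (stick_weight (\<lambda>k. v k \<omega>) n / geom_weight (v 0 \<omega>) n)) sums (\<Sum>n. ?a n)"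
    using elim sums_summable[OF sums] by (intro stick_geom_ln_ratio_sums) auto
  then show ?case
    using sums by (simp add: KL_term_def[abs_def] sums_iff)
qed

lemma KL_term_measurable [measurable]: "(\<lambda>\<omega>. KL_term v \<omega> n) \<in> borel_measurable M"
  unfolding KL_term_def stick_weight_def geom_weight_def by measurable

lemma D_KL_measurable [measurable]: "D_KL v \<in> borel_measurable M"
  unfolding D_KL_def[abs_def] by measurable

lemma AE_D_KL_eq: "AE \<omega> in M. D_KL v \<omega> = (\<Sum>n. gap n \<omega>)"
  using AE_KL_term_sums by eventually_elim (simp add: D_KL_def sums_iff)

lemma AE_D_KL_nonneg: "AE \<omega> in M. 0 \<le> D_KL v \<omega>"
  using AE_D_KL_eq AE_gap_nonneg AE_summable_gap by eventually_elim (simp add: suminf_nonneg)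

lemma has_bochner_integral_D_KL: "has_bochner_integral M (D_KL v) (\<theta> / (\<theta> + 1))"
proof (rule has_bochner_integral_nn_integral)
  have "(\<integral>\<^sup>+\<omega>. ennreal (D_KL v \<omega>) \<partial>M) = (\<integral>\<^sup>+\<omega>. (\<Sum>n. ennreal (gap n \<omega>)) \<partial>M)"
  proof (rule nn_integral_cong_AE)
    show "AE \<omega> in M. ennreal (D_KL v \<omega>) = (\<Sum>n. ennreal (gap n \<omega>))"
      using AE_D_KL_eq AE_gap_nonneg AE_summable_gap by eventually_elim (simp add: suminf_ennreal2)
  qed
  then show "(\<integral>\<^sup>+\<omega>. ennreal (D_KL v \<omega>) \<partial>M) = ennreal (\<theta> / (\<theta> + 1))"
    by (simp add: nn_integral_suminf_gap)
qed (use theta_pos AE_D_KL_nonneg in auto)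

text \<open>The expectations of the diagonal and of the mixed products of gaps are geometric in \<open>n\<close> with ratio
\<open>\<theta> / (\<theta> + 2)\<close> and in the distance \<open>k\<close> with ratio \<open>\<theta> / (\<theta> + 1)\<close>.\<close>

lemma has_bochner_integral_D_KL_sq:
  "has_bochner_integral M (\<lambda>\<omega>. (D_KL v \<omega>)\<^sup>2)
    ((\<theta> + 2) * (\<theta> + 1) * expectation (\<lambda>\<omega>. (1 - v 0 \<omega>)\<^sup>2 * (1 - v 1 \<omega>) *
        binary_div (v 1 \<omega>) (v 0 \<omega>) * binary_div (v 2 \<omega>) (v 0 \<omega>)) +
      (\<theta> + 2) / 2 * expectation (\<lambda>\<omega>. ((1 - v 0 \<omega>) * binary_div (v 1 \<omega>) (v 0 \<omega>))\<^sup>2))"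
proof -
  define cross where "cross \<omega> = (1 - v 0 \<omega>)\<^sup>2 * (1 - v 1 \<omega>) *
    binary_div (v 1 \<omega>) (v 0 \<omega>) * binary_div (v 2 \<omega>) (v 0 \<omega>)" for \<omega>
  define diag where "diag \<omega> = ((1 - v 0 \<omega>) * binary_div (v 1 \<omega>) (v 0 \<omega>))\<^sup>2" for \<omega>
  define c d where "c = expectation cross" and "d = expectation diag"
  have AE_cross: "AE \<omega> in M. 0 \<le> cross \<omega>"
    using AE_v unfolding cross_def
    by eventually_elim (auto intro!: mult_nonneg_nonneg binary_div_nonneg simp: less_imp_le)
  have c: "(\<integral>\<^sup>+\<omega>. ennreal (cross \<omega>) \<partial>M) = ennreal c" "0 \<le> c"
    unfolding c_def using AE_cross integrable_binary_div_mult_binary_div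
    by (auto intro!: nn_integral_eq_integral integral_nonneg_AE simp: cross_def[abs_def])
  have d: "(\<integral>\<^sup>+\<omega>. ennreal (diag \<omega>) \<partial>M) = ennreal d" "0 \<le> d"
    unfolding d_def using integrable_one_minus_v_mult_binary_div_sq
    by (auto intro!: nn_integral_eq_integral integral_nonneg_AE simp: diag_def[abs_def])
  have factor: "d * R + 2 * (c * R * t) = (d + 2 * (c * t)) * R" for R t
    by (simp add: algebra_simps)
  let ?q = "\<theta> / (\<theta> + 1)" and ?r = "\<theta> / (\<theta> + 2)"
  have "(\<integral>\<^sup>+\<omega>. ennreal ((D_KL v \<omega>)\<^sup>2) \<partial>M) =
      (\<integral>\<^sup>+\<omega>. (\<Sum>n. ennreal ((gap n \<omega>)\<^sup>2) + 2 * (\<Sum>k. ennreal (gap n \<omega> * gap (n + Suc k) \<omega>))) \<partial>M)"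
  proof (rule nn_integral_cong_AE)
    show "AE \<omega> in M. ennreal ((D_KL v \<omega>)\<^sup>2) =
        (\<Sum>n. ennreal ((gap n \<omega>)\<^sup>2) + 2 * (\<Sum>k. ennreal (gap n \<omega> * gap (n + Suc k) \<omega>)))"
      using AE_D_KL_eq AE_gap_nonneg AE_summable_gap
      by eventually_elim (simp add: ennreal_square_suminf)
  qed
  also have "\<dots> = (\<Sum>n. (\<integral>\<^sup>+\<omega>. ennreal ((gap n \<omega>)\<^sup>2) \<partial>M) +
      2 * (\<Sum>k. \<integral>\<^sup>+\<omega>. ennreal (gap n \<omega> * gap (n + Suc k) \<omega>) \<partial>M))"
  proof (subst nn_integral_suminf, measurable, intro suminf_cong)
    fix n
    have "(\<integral>\<^sup>+\<omega>. (\<Sum>k. ennreal (gap n \<omega> * gap (n + Suc k) \<omega>)) \<partial>M) =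
        (\<Sum>k. \<integral>\<^sup>+\<omega>. ennreal (gap n \<omega> * gap (n + Suc k) \<omega>) \<partial>M)"
      by (intro nn_integral_suminf) measurable
    then show "(\<integral>\<^sup>+\<omega>. ennreal ((gap n \<omega>)\<^sup>2) + 2 * (\<Sum>k. ennreal (gap n \<omega> * gap (n + Suc k) \<omega>)) \<partial>M) =
        (\<integral>\<^sup>+\<omega>. ennreal ((gap n \<omega>)\<^sup>2) \<partial>M) +
        2 * (\<Sum>k. \<integral>\<^sup>+\<omega>. ennreal (gap n \<omega> * gap (n + Suc k) \<omega>) \<partial>M)"
      by (subst nn_integral_add, measurable, subst nn_integral_cmult, measurable)
  qed
  also have "\<dots> = (\<Sum>n. ennreal ((d + 2 * (c * (\<theta> + 1))) * ?r ^ n))"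
  proof (intro suminf_cong)
    fix n
    have "(\<Sum>k. \<integral>\<^sup>+\<omega>. ennreal (gap n \<omega> * gap (n + Suc k) \<omega>) \<partial>M) = (\<Sum>k. ennreal (c * ?r ^ n * ?q ^ k))"
      unfolding nn_integral_gap_mult_gap cross_def[symmetric] c(1)
      using c(2) theta_pos by (simp add: ennreal_mult[symmetric] mult.assoc)
    also have "\<dots> = ennreal (c * ?r ^ n * (\<theta> + 1))"
      using c(2) theta_pos by (intro suminf_ennreal_eq sums_mult geometric_mean_sums) simp
    finally have "(\<integral>\<^sup>+\<omega>. ennreal ((gap n \<omega>)\<^sup>2) \<partial>M) +
        2 * (\<Sum>k. \<integral>\<^sup>+\<omega>. ennreal (gap n \<omega> * gap (n + Suc k) \<omega>) \<partial>M) =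
      ennreal d * ennreal (?r ^ n) + 2 * ennreal (c * ?r ^ n * (\<theta> + 1))"
      by (simp only: nn_integral_gap_sq diag_def[symmetric] d(1))
    also have "\<dots> = ennreal (d * ?r ^ n + 2 * (c * ?r ^ n * (\<theta> + 1)))"
    proof -
      have "0 \<le> c * ?r ^ n * (\<theta> + 1)" "0 \<le> ?r ^ n"
        using c(2) theta_pos by auto
      then show ?thesis
        using d(2) by (simp only: ennreal_plus ennreal_mult ennreal_numeral mult_nonneg_nonneg zero_le_numeral)
    qed
    also have "d * ?r ^ n + 2 * (c * ?r ^ n * (\<theta> + 1)) = (d + 2 * (c * (\<theta> + 1))) * ?r ^ n"
      by (rule factor)
    finally show "(\<integral>\<^sup>+\<omega>. ennreal ((gap n \<omega>)\<^sup>2) \<partial>M) +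
        2 * (\<Sum>k. \<integral>\<^sup>+\<omega>. ennreal (gap n \<omega> * gap (n + Suc k) \<omega>) \<partial>M) =
      ennreal ((d + 2 * (c * (\<theta> + 1))) * ?r ^ n)" .
  qed
  also have "\<dots> = ennreal ((d + 2 * (c * (\<theta> + 1))) * ((\<theta> + 2) / 2))"
    using c(2) d(2) theta_pos
    by (intro suminf_ennreal_eq sums_mult geometric_second_moment_sums) simp
  also have "(d + 2 * (c * (\<theta> + 1))) * ((\<theta> + 2) / 2) = (\<theta> + 2) * (\<theta> + 1) * c + (\<theta> + 2) / 2 * d"
    by (simp add: field_simps)
  finally have "has_bochner_integral M (\<lambda>\<omega>. (D_KL v \<omega>)\<^sup>2) ((\<theta> + 2) * (\<theta> + 1) * c + (\<theta> + 2) / 2 * d)"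
    using c(2) d(2) theta_pos by (intro has_bochner_integral_nn_integral) auto
  then show ?thesis
    unfolding c_def d_def cross_def diag_def .
qed

text \<open>Convergence of the series already gives absolute convergence: each term is at least
\<open>w n - w' n \<ge> - w' n\<close>, and the geometric weights are summable.\<close>

lemma AE_D_KL_eq_KL_divergence:
  fixes z :: "nat \<Rightarrow> 'a \<Rightarrow> 'b::t1_space"
  assumes inj: "AE \<omega> in M. inj (\<lambda>n. z n \<omega>)"
  shows "AE \<omega> in M. D_KL v \<omega> =
    KL_divergence (exp 1) (geometric_process v z \<omega>) (dirichlet_process v z \<omega>)"
  using inj AE_v AE_KL_term_sums
proof eventually_elim
  case (elim \<omega>)
  define w where "w = stick_weight (\<lambda>k. v k \<omega>)"
  define w' where "w' = geom_weight (v 0 \<omega>)"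
  have v: "0 < v n \<omega>" "v n \<omega> < 1" for n
    using elim(2) by auto
  have w: "0 < w n" for n
    unfolding w_def stick_weight_def using v by (auto intro!: mult_pos_pos prod_pos)
  have w': "0 < w' n" for n
    unfolding w'_def geom_weight_def using v by auto
  have summable_w': "summable w'"
    unfolding w'_def geom_weight_def[abs_def] using v[of 0]
    by (intro summable_mult summable_geometric) auto
  have KL_term: "KL_term v \<omega> = (\<lambda>n. w n * ln (w n / w' n))"
    by (simp add: KL_term_def w_def w'_def fun_eq_iff)
  have "summable (\<lambda>n. w n * ln (w n / w' n))"
    using elim(3) unfolding KL_term by (rule sums_summable)
  then have "summable (\<lambda>n. w n * ln (w n / w' n) + 2 * w' n)"
    using summable_w' by (intro summable_add summable_mult)
  then have "summable (\<lambda>n. \<bar>w n * ln (w n / w' n)\<bar>)"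
  proof (rule summable_comparison_test'[where N = 0])
    fix n
    show "norm \<bar>w n * ln (w n / w' n)\<bar> \<le> w n * ln (w n / w' n) + 2 * w' n"
      using mult_ln_divide_ge_diff[OF w[of n] w'[of n]] w[of n] w'[of n]
      unfolding real_norm_def by linarith
  qed
  then have "KL_divergence (exp 1) (discrete_measure w' (\<lambda>n. z n \<omega>)) (discrete_measure w (\<lambda>n. z n \<omega>)) =
      (\<Sum>n. w n * ln (w n / w' n))"
    using w w' summable_w' elim(1) by (intro KL_divergence_discrete_measure)
  then show ?case
    by (simp add: D_KL_def KL_term geometric_process_def dirichlet_process_def w_def w'_def)
qed

end

(* "KL_divergence b N Q" is the divergence of Q from N, i.e. D_KL(Q||N), in base b. The
   integrability conjuncts ensure that no integral below takes the default value 0. *)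
theorem lemma3:
  fixes M :: "'a measure" and P0 :: "'b::polish_space measure"
    and v :: "nat \<Rightarrow> 'a \<Rightarrow> real" and z :: "nat \<Rightarrow> 'a \<Rightarrow> 'b"
    and \<theta> \<rho> :: real
  assumes "prob_space M"
    and "\<theta> > 0"
    and "prob_space.indep_vars M (\<lambda>_. borel) v UNIV"
    and "\<And>n. distributed M lborel (v n) (beta_density 1 \<theta>)"
    and "prob_space P0" and "sets P0 = sets borel" and "nonatomic P0"
    and "prob_space.indep_vars M (\<lambda>_. borel) z UNIV"
    and "\<And>n. distr M borel (z n) = P0"
    and "prob_space.indep_set M
           (sets (vimage_algebra (space M) (\<lambda>\<omega> n. v n \<omega>) (\<Pi>\<^sub>M n\<in>UNIV. borel)))
           (sets (vimage_algebra (space M) (\<lambda>\<omega> n. z n \<omega>) (\<Pi>\<^sub>M n\<in>UNIV. borel)))"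
    and "\<rho> = 1 / (\<theta> + 1)"
  shows "(AE \<omega> in M. summable (KL_term v \<omega>) \<and>
            D_KL v \<omega> = KL_divergence (exp 1) (geometric_process v z \<omega>) (dirichlet_process v z \<omega>)) \<and>
         integrable M (D_KL v) \<and>
         integrable M (\<lambda>\<omega>. (D_KL v \<omega>)\<^sup>2) \<and>
         integrable M (\<lambda>\<omega>. (1 - v 0 \<omega>)\<^sup>2 * (1 - v 1 \<omega>) *
           binary_div (v 1 \<omega>) (v 0 \<omega>) * binary_div (v 2 \<omega>) (v 0 \<omega>)) \<and>
         integrable M (\<lambda>\<omega>. ((1 - v 0 \<omega>) * binary_div (v 1 \<omega>) (v 0 \<omega>))\<^sup>2) \<and>
         prob_space.expectation M (D_KL v) = \<theta> / (\<theta> + 1) \<and>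
         prob_space.variance M (D_KL v) =
           (\<theta> + 2) * (\<theta> + 1) *
             prob_space.expectation M (\<lambda>\<omega>. (1 - v 0 \<omega>)\<^sup>2 * (1 - v 1 \<omega>) *
               binary_div (v 1 \<omega>) (v 0 \<omega>) * binary_div (v 2 \<omega>) (v 0 \<omega>)) +
           (\<theta> + 2) / 2 *
             prob_space.expectation M (\<lambda>\<omega>. ((1 - v 0 \<omega>) * binary_div (v 1 \<omega>) (v 0 \<omega>))\<^sup>2) -
           (1 - \<rho>)\<^sup>2"
proof -
  interpret beta_sticks M v \<theta>
    using assms(1-4) by (simp add: beta_sticks_def beta_sticks_axioms_def)
  have "AE \<omega> in M. inj (\<lambda>n. z n \<omega>)"
    using assms(8) nonatomic_emeasure_singleton[OF assms(7,6)]
    by (intro AE_indep_vars_inj) (simp_all only: assms(9))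
  from AE_D_KL_eq_KL_divergence[OF this] AE_KL_term_sums
  have KL: "AE \<omega> in M. summable (KL_term v \<omega>) \<and>
      D_KL v \<omega> = KL_divergence (exp 1) (geometric_process v z \<omega>) (dirichlet_process v z \<omega>)"
    by eventually_elim (simp add: sums_iff)
  have mean: "integrable M (D_KL v)" "expectation (D_KL v) = \<theta> / (\<theta> + 1)"
    using has_bochner_integral_D_KL by (simp_all only: has_bochner_integral_iff)
  note square = has_bochner_integral_D_KL_sq[unfolded has_bochner_integral_iff]
  have rho: "\<theta> / (\<theta> + 1) = 1 - \<rho>"
    using assms(2,11) by (simp add: field_simps)
  have "variance (D_KL v) = expectation (\<lambda>\<omega>. (D_KL v \<omega>)\<^sup>2) - (1 - \<rho>)\<^sup>2"
    using variance_eq[OF mean(1) square[THEN conjunct1]] by (simp only: mean(2) rho)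
  note variance = this[unfolded square[THEN conjunct2]]
  show ?thesis
    by (intro conjI KL mean square[THEN conjunct1] variance
        integrable_binary_div_mult_binary_div integrable_one_minus_v_mult_binary_div_sq)
qed

end
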